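(* In the matched graph-Gaussian setting described in the context, let $\mathcal{S}_k\subset\{1,\dots,M\}$ be the current observation set, let $i\in\{1,\dots,M\}\setminus\mathcal{S}_k$, let $\boldsymbol{W}_k=\mathrm{diag}(w_{k,1},\dots,w_{k,M})\succeq0$ be a fixed diagonal matrix, and let $\rho_g>0$. Define the unclipped graph-refined estimates $$\widetilde{\boldsymbol{x}}_{0|t,\mathcal{S}}=\widehat{\boldsymbol{x}}_{0|t}+\rho_g\boldsymbol{m}_{\mathcal{S},t}\qquad(\mathcal{S}=\mathcal{S}_k\text{ or }\mathcal{S}=\mathcal{S}_k\cup\{i\}),$$ the one-step reconstruction improvement $$\Delta_i(\rho_g)=\left\Vert\boldsymbol{x}_0-\widetilde{\boldsymbol{x}}_{0|t,\mathcal{S}_k}\right\Vert_{\boldsymbol{W}_k}^2-\left\Vert\boldsymbol{x}_0-\widetilde{\boldsymbol{x}}_{0|t,\mathcal{S}_k\cup\{i\}}\right\Vert_{\boldsymbol{W}_k}^2,$$ and the utility $$U_i(\mathcal{S}_k)=\mathrm{tr}\left(\boldsymbol{W}_k\boldsymbol{\Sigma}_{\mathcal{S}_k}\right)-\mathrm{tr}\left(\boldsymbol{W}_k\boldsymbol{\Sigma}_{\mathcal{S}_k\cup\{i\}}\right).$$ Then $$\mathbb{E}\left[\Delta_i(\rho_g)\mid\mathcal{F}_k\right]=(2\rho_g-\rho_g^2)\,U_i(\mathcal{S}_k).$$ Consequently, if $0<\rho_g<2$, then for every nonempty candidate set $\mathcal{C}_k\subseteq\{1,\dots,M\}\setminus\mathcal{S}_k$,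 any maximizer of $i\mapsto U_i(\mathcal{S}_k)$ over $\mathcal{C}_k$ also maximizes $i\mapsto\mathbb{E}[\Delta_i(\rho_g)\mid\mathcal{F}_k]$ over $\mathcal{C}_k$.
   Context: Setting. Let $\boldsymbol{C}_g=[c_{ij}]\in\mathbb{R}^{M\times M}$ be symmetric with nonnegative entries, $\boldsymbol{L}_g=\mathrm{diag}(\boldsymbol{C}_g\boldsymbol{1})-\boldsymbol{C}_g$, and $\boldsymbol{Q}_g=\tau\boldsymbol{I}+\lambda\boldsymbol{L}_g$ with $\tau>0$, $\lambda\ge 0$. A vector $\widehat{\boldsymbol{x}}_{0|t}\in\mathbb{R}^M$ is fixed, the residual $\boldsymbol{\delta}\in\mathbb{R}^M$ has prior law $\mathcal{N}(\boldsymbol{0},\boldsymbol{Q}_g^{-1})$, and the target is $\boldsymbol{x}_0=\widehat{\boldsymbol{x}}_{0|t}+\boldsymbol{\delta}$ ("matched" means the true residual follows this model). Observations are noisy point observations: for an observation set $\mathcal{S}\subseteq\{1,\dots,M\}$, $\boldsymbol{y}_{\mathcal{S}}=\boldsymbol{H}_{\mathcal{S}}\boldsymbol{x}_0+\boldsymbol{\eta}_{\mathcal{S}}$, where the rows of $\boldsymbol{H}_{\mathcal{S}}$ are $\boldsymbol{e}_j^{\mathsf{T}}$, $j\in\mathcal{S}$ ($\boldsymbol{e}_j$ is the $j$th canonical basis vector of $\mathbb{R}^M$), and $\boldsymbol{\eta}_{\mathcal{S}}\sim\mathcal{N}(\boldsymbol{0},\boldsymbol{R}_{\mathcal{S}})$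 with $\boldsymbol{R}_{\mathcal{S}}\succ0$ is independent of $\boldsymbol{\delta}$. The prospective measurement at any $i\notin\mathcal{S}_k$ is $y_i=\boldsymbol{e}_i^{\mathsf{T}}\boldsymbol{x}_0+\eta_i$ with $\eta_i\sim\mathcal{N}(0,\sigma_y^2)$, $\sigma_y^2>0$, and $\eta_i$ independent of $(\boldsymbol{\delta},\boldsymbol{\eta}_{\mathcal{S}_k})$; so $\boldsymbol{R}_{\mathcal{S}_k\cup\{i\}}$ is block diagonal with blocks $\boldsymbol{R}_{\mathcal{S}_k}$ and $\sigma_y^2$. Posterior quantities. For an observation set $\mathcal{S}$, let $\boldsymbol{A}_{\mathcal{S}}=\boldsymbol{Q}_g+\boldsymbol{H}_{\mathcal{S}}^{\mathsf{T}}\boldsymbol{R}_{\mathcal{S}}^{-1}\boldsymbol{H}_{\mathcal{S}}$, $\boldsymbol{\Sigma}_{\mathcal{S}}=\boldsymbol{A}_{\mathcal{S}}^{-1}$, and $\boldsymbol{m}_{\mathcal{S},t}=\boldsymbol{A}_{\mathcal{S}}^{-1}\boldsymbol{H}_{\mathcal{S}}^{\mathsf{T}}\boldsymbol{R}_{\mathcal{S}}^{-1}(\boldsymbol{y}_{\mathcal{S}}-\boldsymbol{H}_{\mathcal{S}}\widehat{\boldsymbol{x}}_{0|t})$; these are the posterior covariance and mean of $\boldsymbol{\delta}$ given $\boldsymbol{y}_{\mathcal{S}}$ (for $\mathcal{S}=\varnothing$: $\boldsymbol{A}_\varnothing=\boldsymbol{Q}_g$, $\boldsymbol{m}_{\varnothing,t}=\boldsymbol{0}$).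 Conditioning on $\mathcal{F}_k$ means conditioning on everything known at round $k$: $\boldsymbol{C}_g$, $\widehat{\boldsymbol{x}}_{0|t}$, $\mathcal{S}_k$, $\boldsymbol{y}_{\mathcal{S}_k}$ and $\boldsymbol{W}_k$. Thus, given $\mathcal{F}_k$, under the model $\boldsymbol{\delta}\sim\mathcal{N}(\boldsymbol{m}_{\mathcal{S}_k,t},\boldsymbol{\Sigma}_{\mathcal{S}_k})$ and $\eta_i\sim\mathcal{N}(0,\sigma_y^2)$ independently of $\boldsymbol{\delta}$. For $\boldsymbol{B}\succeq0$, $\|\boldsymbol{v}\|_{\boldsymbol{B}}^2=\boldsymbol{v}^{\mathsf{T}}\boldsymbol{B}\boldsymbol{v}$. *)

theory Defs
  imports "HOL-Probability.Probability"
begin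

section \<open>Linear algebra over a finite set of indices\<close>

text \<open>
  Observation sets are arbitrary (possibly empty) subsets of the index type, so vectors and matrices
  indexed by such a set \<open>S\<close> are represented by functions of type \<open>'n \<Rightarrow> real\<close> and
  \<open>'n \<Rightarrow> 'n \<Rightarrow> real\<close> of which only the values at indices in \<open>S\<close> matter.
\<close>

definition posdef_on :: "'n set \<Rightarrow> ('n \<Rightarrow> 'n \<Rightarrow> real) \<Rightarrow> bool" where
  "posdef_on S A \<longleftrightarrow>
     (\<forall>j\<in>S. \<forall>l\<in>S. A j l = A l j) \<and>
     (\<forall>v. (\<exists>j\<in>S. v j \<noteq> 0) \<longrightarrow> (\<Sum>j\<in>S. \<Sum>l\<in>S. v j * A j l * v l) > 0)"

definition inverse_on :: "'n set \<Rightarrow> ('n \<Rightarrow> 'n \<Rightarrow> real) \<Rightarrow> 'n \<Rightarrow> 'n \<Rightarrow> real" where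
  "inverse_on S A = (SOME B. \<forall>j\<in>S. \<forall>l\<in>S.
     (\<Sum>k\<in>S. A j k * B k l) = (if j = l then 1 else 0) \<and>
     (\<Sum>k\<in>S. B j k * A k l) = (if j = l then 1 else 0))"

definition det_on :: "'n set \<Rightarrow> ('n \<Rightarrow> 'n \<Rightarrow> real) \<Rightarrow> real" where
  "det_on S A = (\<Sum>p | p permutes S. of_int (sign p) * (\<Prod>j\<in>S. A j (p j)))"

lemma det_on_UNIV: "det_on UNIV (\<lambda>j l. A $ j $ l) = det (A :: real^'n^'n)"
  by (simp add: det_on_def det_def)

lemma inverse_on_UNIV:
  fixes A :: "real^'n^'n"
  assumes "invertible A"
  shows "inverse_on UNIV (\<lambda>j l. A $ j $ l) = (\<lambda>j l. matrix_inv A $ j $ l)"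
proof -
  let ?P = "\<lambda>B. \<forall>j\<in>UNIV. \<forall>l\<in>UNIV.
     (\<Sum>k\<in>UNIV. A $ j $ k * B k l) = (if j = l then 1 else 0) \<and>
     (\<Sum>k\<in>UNIV. B j k * A $ k $ l) = (if j = l then 1 else 0)"
  have iff: "?P (\<lambda>j l. B $ j $ l) \<longleftrightarrow> A ** B = mat 1 \<and> B ** A = mat 1" for B :: "real^'n^'n"
    by (auto simp: vec_eq_iff matrix_matrix_mult_def mat_def)
  have inv: "A ** matrix_inv A = mat 1" "matrix_inv A ** A = mat 1"
    using assms unfolding invertible_def matrix_inv_def by (metis (mono_tags, lifting) someI_ex)+
  then have "?P (\<lambda>j l. matrix_inv A $ j $ l)"
    by (simp only: iff simp_thms)
  then have *: "?P (inverse_on UNIV (\<lambda>j l. A $ j $ l))"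
    unfolding inverse_on_def by (rule someI[where P = ?P])
  define B :: "real^'n^'n" where "B = (\<chi> j l. inverse_on UNIV (\<lambda>j l. A $ j $ l) j l)"
  have "A ** B = mat 1"
    using iff[of B] * unfolding B_def vec_lambda_beta by blast
  then have "B = matrix_inv A"
    by (metis inv(2) matrix_mul_assoc matrix_mul_lid matrix_mul_rid)
  then show ?thesis
    by (auto simp: fun_eq_iff B_def vec_eq_iff)
qed

definition diag_matrix :: "real^'n \<Rightarrow> real^'n^'n" where
  "diag_matrix d = (\<chi> i j. if i = j then d $ i else 0)"

definition possemidef :: "real^'n^'n \<Rightarrow> bool" where
  "possemidef B \<longleftrightarrow> transpose B = B \<and> (\<forall>v. 0 \<le> v \<bullet> (B *v v))"

definition weighted_norm_sq :: "real^'n^'n \<Rightarrow> real^'n \<Rightarrow> real" where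
  "weighted_norm_sq B v = v \<bullet> (B *v v)"


section \<open>Gaussian vectors and independence\<close>

definition mvn_density_on ::
    "'n set \<Rightarrow> ('n \<Rightarrow> real) \<Rightarrow> ('n \<Rightarrow> 'n \<Rightarrow> real) \<Rightarrow> ('n \<Rightarrow> real) \<Rightarrow> real" where
  "mvn_density_on S \<mu> \<Sigma> v =
     exp (- (1/2) * (\<Sum>j\<in>S. \<Sum>l\<in>S. (v j - \<mu> j) * inverse_on S \<Sigma> j l * (v l - \<mu> l)))
       / sqrt ((2 * pi) ^ card S * det_on S \<Sigma>)"

text \<open>The law of \<open>X\<close> is the nondegenerate normal law \<open>\<N>(\<mu>, \<Sigma>)\<close> on the space of
  \<open>S\<close>-indexed vectors, which for \<open>S = {}\<close> is a single point.\<close>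

definition gaussian_on ::
    "'w measure \<Rightarrow> 'n set \<Rightarrow> ('w \<Rightarrow> 'n \<Rightarrow> real) \<Rightarrow> ('n \<Rightarrow> real) \<Rightarrow> ('n \<Rightarrow> 'n \<Rightarrow> real) \<Rightarrow> bool" where
  "gaussian_on P S X \<mu> \<Sigma> \<longleftrightarrow>
     distributed P (PiM S (\<lambda>_. lborel)) X (\<lambda>v. ennreal (mvn_density_on S \<mu> \<Sigma> v))"

text \<open>The library's \<open>indep_var\<close> forces both random variables to have values in the same type,
  so independence is expressed through the generated \<open>\<sigma>\<close>-algebras.\<close>

definition indep_rv ::
    "'w measure \<Rightarrow> 'a measure \<Rightarrow> ('w \<Rightarrow> 'a) \<Rightarrow> 'b measure \<Rightarrow> ('w \<Rightarrow> 'b) \<Rightarrow> bool" where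
  "indep_rv P M X N Y \<longleftrightarrow> X \<in> measurable P M \<and> Y \<in> measurable P N \<and>
     prob_space.indep_set P (sets (vimage_algebra (space P) X M))
                            (sets (vimage_algebra (space P) Y N))"


section \<open>Graph prior, observations and posterior\<close>

definition graph_laplacian :: "real^'n^'n \<Rightarrow> real^'n^'n" where
  "graph_laplacian C = diag_matrix (C *v 1) - C"

definition prior_precision :: "real \<Rightarrow> real \<Rightarrow> real^'n^'n \<Rightarrow> real^'n^'n" where
  "prior_precision \<tau> lam C = \<tau> *\<^sub>R mat 1 + lam *\<^sub>R graph_laplacian C"

text \<open>Row \<open>j\<close> of the observation matrix \<open>H\<^sub>S\<close>, for \<open>j \<in> S\<close>.\<close>

definition obs_row :: "'n \<Rightarrow> real^'n" where
  "obs_row j = axis j 1"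

definition observe :: "'n set \<Rightarrow> real^'n \<Rightarrow> ('n \<Rightarrow> real) \<Rightarrow> 'n \<Rightarrow> real" where
  "observe S x e = (\<lambda>j\<in>S. obs_row j \<bullet> x + e j)"

text \<open>The matrix \<open>Q + H\<^sub>S\<^sup>T R\<^sup>-\<^sup>1 H\<^sub>S\<close>.\<close>

definition post_precision :: "real^'n^'n \<Rightarrow> 'n set \<Rightarrow> ('n \<Rightarrow> 'n \<Rightarrow> real) \<Rightarrow> real^'n^'n" where
  "post_precision Q S R =
     Q + (\<chi> a b. \<Sum>j\<in>S. \<Sum>l\<in>S. obs_row j $ a * inverse_on S R j l * obs_row l $ b)"

definition post_cov :: "real^'n^'n \<Rightarrow> 'n set \<Rightarrow> ('n \<Rightarrow> 'n \<Rightarrow> real) \<Rightarrow> real^'n^'n" where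
  "post_cov Q S R = matrix_inv (post_precision Q S R)"

text \<open>The vector \<open>A\<^sup>-\<^sup>1 H\<^sub>S\<^sup>T R\<^sup>-\<^sup>1 (y - H\<^sub>S x)\<close>, where \<open>A\<close> is the posterior precision.\<close>

definition post_mean ::
    "real^'n^'n \<Rightarrow> 'n set \<Rightarrow> ('n \<Rightarrow> 'n \<Rightarrow> real) \<Rightarrow> real^'n \<Rightarrow> ('n \<Rightarrow> real) \<Rightarrow> real^'n" where
  "post_mean Q S R x y = post_cov Q S R *v
     (\<Sum>j\<in>S. (\<Sum>l\<in>S. inverse_on S R j l * (y l - obs_row l \<bullet> x)) *\<^sub>R obs_row j)"

text \<open>Noise covariance on \<open>insert i S\<close>, block diagonal with blocks \<open>R\<close> and \<open>s\<close>.\<close>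

definition extend_cov ::
    "'n set \<Rightarrow> ('n \<Rightarrow> 'n \<Rightarrow> real) \<Rightarrow> 'n \<Rightarrow> real \<Rightarrow> 'n \<Rightarrow> 'n \<Rightarrow> real" where
  "extend_cov S R i s = (\<lambda>j l. if j \<in> S \<and> l \<in> S then R j l else if j = i \<and> l = i then s else 0)"

definition refined_estimate ::
    "real^'n^'n \<Rightarrow> 'n set \<Rightarrow> ('n \<Rightarrow> 'n \<Rightarrow> real) \<Rightarrow> real^'n \<Rightarrow> real \<Rightarrow> ('n \<Rightarrow> real) \<Rightarrow> real^'n" where
  "refined_estimate Q S R x \<rho> y = x + \<rho> *\<^sub>R post_mean Q S R x y"

definition utility ::
    "real^'n^'n \<Rightarrow> real^'n^'n \<Rightarrow> 'n set \<Rightarrow> ('n \<Rightarrow> 'n \<Rightarrow> real) \<Rightarrow> real \<Rightarrow> 'n \<Rightarrow> real" where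
  "utility W Q S R s i =
     trace (W ** post_cov Q S R) - trace (W ** post_cov Q (insert i S) (extend_cov S R i s))"

end

theory Submission
  imports Defs "HOL-Real_Asymp.Real_Asymp"
begin

text \<open>
  Write \<open>m\<close> and \<open>\<Sigma>\<close> for the posterior mean and covariance, and \<open>r = \<delta> - m\<close>. Completing the square in
  the joint density of \<open>\<delta>\<close> and the noise shows that the joint density of \<open>r\<close> and \<open>y\<close> factorizes; so
  \<open>r\<close> is independent of \<open>y\<close> with density proportional to \<open>exp (- r\<^sup>T \<Sigma>\<^sup>-\<^sup>1 r / 2)\<close>. Its first two moments
  \<open>0\<close> and \<open>\<Sigma>\<close> are read off the moment generating function, which only requires a translation, so that
  no normalizing constant is ever evaluated.

  By the Sherman-Morrison identity, one more observation \<open>y\<^sub>i\<close> moves the mean to \<open>m + \<nu> k\<close> with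
  innovation \<open>\<nu> = r\<^sub>i + \<eta>\<^sub>i\<close> and gain \<open>k = \<Sigma> e\<^sub>i / (\<sigma>\<^sup>2 + \<Sigma>\<^sub>i\<^sub>i)\<close>. Hence
  \<open>\<Delta>\<^sub>i = 2 \<rho> \<nu> k\<^sup>T W (r + (1 - \<rho>) m) - \<rho>\<^sup>2 \<nu>\<^sup>2 k\<^sup>T W k\<close>. Given \<open>y\<close>, the innovation has mean \<open>0\<close>, variance
  \<open>\<sigma>\<^sup>2 + \<Sigma>\<^sub>i\<^sub>i\<close> and covariance \<open>\<Sigma> e\<^sub>i\<close> with \<open>r\<close>, and the utility is \<open>U\<^sub>i = k\<^sup>T W \<Sigma> e\<^sub>i\<close>; thus the two terms
  contribute \<open>2 \<rho> U\<^sub>i\<close> and \<open>- \<rho>\<^sup>2 U\<^sub>i\<close>.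
\<close>

section \<open>Positive definite matrices\<close>

definition posdef :: "real^'n^'n \<Rightarrow> bool" where
  "posdef A \<longleftrightarrow> transpose A = A \<and> (\<forall>v. v \<noteq> 0 \<longrightarrow> 0 < v \<bullet> (A *v v))"

lemma inner_symmetric_matrix:
  fixes A :: "real^'n^'n"
  assumes "transpose A = A"
  shows "x \<bullet> (A *v y) = (A *v x) \<bullet> y"
proof -
  have "x v* A = A *v x"
    using vector_transpose_matrix[of x A] unfolding assms .
  then show ?thesis
    using dot_lmul_matrix[of x A y] by (simp only:)
qed

text \<open>Positivity forces a trivial kernel, which gives a left and hence a two-sided inverse.
  The transpose of that inverse is again a left inverse of the symmetric \<open>A\<close>, so it
  coincides with it.\<close>

lemma posdef_matrix_inv:
  assumes "posdef A"
  shows "A ** matrix_inv A = mat 1" "matrix_inv A ** A = mat 1" "transpose (matrix_inv A) = matrix_inv A"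
proof -
  have "\<forall>x. A *v x = 0 \<longrightarrow> x = 0"
    using assms unfolding posdef_def by (metis inner_zero_right less_irrefl)
  then have "\<exists>B. B ** A = mat 1"
    using matrix_left_invertible_ker[of A] by blast
  then have "invertible A"
    unfolding invertible_def using matrix_left_right_inverse by blast
  then have *: "A ** matrix_inv A = mat 1 \<and> matrix_inv A ** A = mat 1"
    unfolding invertible_def matrix_inv_def by (rule someI_ex)
  then show 1: "A ** matrix_inv A = mat 1" and 2: "matrix_inv A ** A = mat 1" by auto
  have "transpose (matrix_inv A) ** A = mat 1"
    using 1 assms unfolding posdef_def by (metis matrix_transpose_mul transpose_mat)
  then show "transpose (matrix_inv A) = matrix_inv A"
    by (metis 1 matrix_mul_assoc matrix_mul_lid matrix_mul_rid)
qed

lemma matrix_inv_vec: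
  assumes "posdef A"
  shows "A *v (matrix_inv A *v x) = x" "matrix_inv A *v (A *v x) = x"
  by (simp_all only: matrix_vector_mul_assoc posdef_matrix_inv(1,2)[OF assms] matrix_vector_mul_lid)

text \<open>Substituting \<open>v = A *v w\<close> turns the form of the inverse at \<open>v\<close>
  into the form of \<open>A\<close> at \<open>w\<close>.\<close>

lemma posdef_matrix_inv_posdef:
  assumes "posdef A"
  shows "posdef (matrix_inv A)"
  unfolding posdef_def
proof (intro conjI allI impI)
  show "transpose (matrix_inv A) = matrix_inv A" by (rule posdef_matrix_inv[OF assms])
  fix v :: "real^'a" assume "v \<noteq> 0"
  then have "matrix_inv A *v v \<noteq> 0"
    using matrix_inv_vec(1)[OF assms, of v] by auto
  then have "0 < (matrix_inv A *v v) \<bullet> (A *v (matrix_inv A *v v))"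
    using assms unfolding posdef_def by blast
  then show "0 < v \<bullet> (matrix_inv A *v v)"
    by (simp add: matrix_inv_vec[OF assms] inner_commute)
qed

lemma matrix_inv_eqI:
  fixes A :: "real^'n^'n"
  assumes "A ** B = mat 1"
  shows "matrix_inv A = B"
proof -
  have BA: "B ** A = mat 1" using assms by (rule iffD1[OF matrix_left_right_inverse])
  have "A ** matrix_inv A = mat 1 \<and> matrix_inv A ** A = mat 1"
    unfolding matrix_inv_def by (rule someI[of _ B]) (intro conjI assms BA)
  then have 1: "A ** matrix_inv A = mat 1" ..
  have "matrix_inv A = (B ** A) ** matrix_inv A"
    unfolding BA matrix_mul_lid ..
  also have "\<dots> = B ** (A ** matrix_inv A)"
    by (rule matrix_mul_assoc[symmetric])
  also have "\<dots> = B"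
    unfolding 1 by (rule matrix_mul_rid)
  finally show ?thesis .
qed

lemma matrix_inv_involutive:
  assumes "posdef A"
  shows "matrix_inv (matrix_inv A) = A"
  by (rule matrix_inv_eqI) (rule posdef_matrix_inv[OF assms])

lemma posdef_add_psd:
  assumes "posdef A" "transpose B = B" "\<And>v. 0 \<le> v \<bullet> (B *v v)"
  shows "posdef (A + B)"
  unfolding posdef_def
proof (intro conjI allI impI)
  show "transpose (A + B) = A + B"
    using assms unfolding posdef_def by (simp add: transpose_def vec_eq_iff)
  show "0 < v \<bullet> ((A + B) *v v)" if "v \<noteq> 0" for v
    using assms that unfolding posdef_def
    by (simp add: matrix_vector_mult_add_rdistrib inner_add_right add_pos_nonneg)
qed

section \<open>The graph Laplacian and the prior precision\<close>

lemma diag_matrix_vec: "(diag_matrix d *v v) $ a = d $ a * v $ a"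
  by (simp add: diag_matrix_def matrix_vector_mult_def if_distrib[of "\<lambda>x. x * _"] cong: if_cong)

text \<open>This is the Dirichlet energy of the graph. The sum runs over ordered pairs and meets
  each edge twice, hence the division by 2; symmetry of \<open>C\<close> identifies the sums of the
  two squares.\<close>

lemma graph_laplacian_quadratic_form:
  fixes C :: "real^'n^'n"
  assumes "transpose C = C"
  shows "v \<bullet> (graph_laplacian C *v v) = (\<Sum>i\<in>UNIV. \<Sum>j\<in>UNIV. C $ i $ j * (v $ i - v $ j)\<^sup>2) / 2"
proof -
  have s: "C $ i $ j = C $ j $ i" for i j
    using assms by (metis transpose_def vec_lambda_beta)
  let ?D = "\<Sum>i\<in>UNIV. \<Sum>j\<in>UNIV. C $ i $ j * (v $ i)\<^sup>2"
  let ?E = "\<Sum>i\<in>UNIV. \<Sum>j\<in>UNIV. C $ i $ j * (v $ i * v $ j)"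
  have 1: "(\<Sum>i\<in>UNIV. \<Sum>j\<in>UNIV. C $ i $ j * (v $ j)\<^sup>2) = ?D"
    by (subst sum.swap) (simp add: s)
  have "(\<Sum>i\<in>UNIV. \<Sum>j\<in>UNIV. C $ i $ j * (v $ i - v $ j)\<^sup>2) = ?D - 2 * ?E + (\<Sum>i\<in>UNIV. \<Sum>j\<in>UNIV. C $ i $ j * (v $ j)\<^sup>2)"
    by (simp add: power2_diff algebra_simps sum.distrib sum_subtractf sum_distrib_left)
  moreover have "v \<bullet> (diag_matrix (C *v 1) *v v) = ?D"
    by (simp add: inner_vec_def diag_matrix_vec)
       (simp add: matrix_vector_mult_def sum_distrib_left sum_distrib_right power2_eq_square mult_ac)
  moreover have "v \<bullet> (C *v v) = ?E"
    by (simp add: inner_vec_def matrix_vector_mult_def sum_distrib_left mult_ac)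
  then have "v \<bullet> (graph_laplacian C *v v) = v \<bullet> (diag_matrix (C *v 1) *v v) - ?E"
    by (simp add: graph_laplacian_def matrix_vector_mult_diff_rdistrib inner_diff_right)
  ultimately show ?thesis using 1 by simp
qed

text \<open>The identity part is strictly positive, and the Laplacian part is nonnegative because
  its Dirichlet energy has nonnegative weights.\<close>

lemma posdef_prior_precision:
  fixes C :: "real^'n^'n"
  assumes "transpose C = C" "\<And>i j. 0 \<le> C $ i $ j" "0 < \<tau>" "0 \<le> lam"
  shows "posdef (prior_precision \<tau> lam C)"
  unfolding prior_precision_def
proof (rule posdef_add_psd)
  have "(\<tau> *\<^sub>R mat 1) *v v = \<tau> *\<^sub>R v" for v :: "real^'n"
    by (simp add: scaleR_matrix_vector_assoc[symmetric])
  moreover have "transpose (\<tau> *\<^sub>R mat 1) = (\<tau> *\<^sub>R mat 1 :: real^'n^'n)"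
    by (simp add: transpose_def vec_eq_iff mat_def)
  ultimately show "posdef (\<tau> *\<^sub>R mat 1 :: real^'n^'n)"
    using assms(3) by (simp add: posdef_def)
  have "C $ i $ j = C $ j $ i" for i j
    using assms(1) by (metis transpose_def vec_lambda_beta)
  then show "transpose (lam *\<^sub>R graph_laplacian C) = lam *\<^sub>R graph_laplacian C"
    by (auto simp: transpose_def vec_eq_iff graph_laplacian_def diag_matrix_def)
  show "0 \<le> v \<bullet> (lam *\<^sub>R graph_laplacian C *v v)" for v
    using assms by (simp add: scaleR_matrix_vector_assoc[symmetric] graph_laplacian_quadratic_form sum_nonneg)
qed

section \<open>Matrices on an index set\<close>

text \<open>The predicate under the choice operator in \<open>inverse_on\<close>. It leaves the
  values of \<open>B\<close> outside \<open>S\<close> unconstrained, so uniqueness can hold only for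
  indices in \<open>S\<close>.\<close>

definition is_inverse_on :: "'n set \<Rightarrow> ('n \<Rightarrow> 'n \<Rightarrow> real) \<Rightarrow> ('n \<Rightarrow> 'n \<Rightarrow> real) \<Rightarrow> bool" where
  "is_inverse_on S A B \<longleftrightarrow> (\<forall>j\<in>S. \<forall>l\<in>S.
     (\<Sum>k\<in>S. A j k * B k l) = (if j = l then 1 else 0) \<and>
     (\<Sum>k\<in>S. B j k * A k l) = (if j = l then 1 else 0))"

text \<open>The usual computation B = B (A B') = (B A) B' = B', carried out with sums over
  \<open>S\<close>.\<close>

lemma is_inverse_on_unique:
  assumes "finite S" "is_inverse_on S A B" "is_inverse_on S A B'" "j \<in> S" "l \<in> S"
  shows "B j l = B' j l"
proof -
  have "B j l = (\<Sum>k\<in>S. B j k * (if k = l then 1 else 0))"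
    using assms by (simp add: if_distrib[of "\<lambda>x. _ * x"] cong: if_cong)
  also have "\<dots> = (\<Sum>k\<in>S. B j k * (\<Sum>m\<in>S. A k m * B' m l))"
    using assms unfolding is_inverse_on_def by (intro sum.cong) auto
  also have "\<dots> = (\<Sum>m\<in>S. (\<Sum>k\<in>S. B j k * A k m) * B' m l)"
    unfolding sum_distrib_left sum_distrib_right by (subst sum.swap) (simp add: mult.assoc)
  also have "\<dots> = (\<Sum>m\<in>S. (if j = m then 1 else 0) * B' m l)"
    using assms unfolding is_inverse_on_def by (intro sum.cong) auto
  also have "\<dots> = B' j l"
    using assms by (simp add: if_distrib[of "\<lambda>x. x * _"] cong: if_cong)
  finally show ?thesis .
qed

text \<open>Padding with the identity outside \<open>S\<close> produces a square matrix over the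
  whole index type. Its kernel is trivial, and the \<open>S\<close>-block of its inverse inverts
  \<open>A\<close>.\<close>

lemma posdef_on_ex_inverse:
  fixes A :: "'n::finite \<Rightarrow> 'n \<Rightarrow> real"
  assumes "posdef_on S A"
  shows "\<exists>B. is_inverse_on S A B"
proof -
  define M :: "real^'n^'n" where
    "M = (\<chi> j l. if j \<in> S \<and> l \<in> S then A j l else if j = l then 1 else 0)"
  have "x = 0" if "M *v x = 0" for x
  proof -
    \<comment> \<open>Outside \<open>S\<close> the padded matrix acts as the identity, so a kernel
      vector is supported in \<open>S\<close>; there the form of \<open>A\<close> at it is zero, and
      positivity makes it vanish.\<close>
    have 1: "(M *v x) $ j = x $ j" if "j \<notin> S" for j
      using that by (simp add: M_def matrix_vector_mult_def if_distrib[of "\<lambda>x. x * _"] cong: if_cong)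
    have off: "x $ j = 0" if "j \<notin> S" for j
      using 1[OF that] \<open>M *v x = 0\<close> by simp
    have 2: "(M *v x) $ j = (\<Sum>l\<in>S. A j l * x $ l)" if "j \<in> S" for j
    proof -
      have "(M *v x) $ j = (\<Sum>l\<in>UNIV. M $ j $ l * x $ l)" by (simp add: matrix_vector_mult_def)
      also have "\<dots> = (\<Sum>l\<in>S. M $ j $ l * x $ l)"
        by (rule sum.mono_neutral_right) (auto simp: off)
      also have "\<dots> = (\<Sum>l\<in>S. A j l * x $ l)"
        using that by (intro sum.cong) (auto simp: M_def)
      finally show ?thesis .
    qed
    have "(\<Sum>j\<in>S. \<Sum>l\<in>S. x $ j * A j l * x $ l) = (\<Sum>j\<in>S. x $ j * (M *v x) $ j)"
      by (intro sum.cong refl) (simp add: 2 sum_distrib_left mult.assoc)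
    also have "\<dots> = 0" using that by simp
    finally have "\<not> (\<exists>j\<in>S. x $ j \<noteq> 0)"
      using assms[unfolded posdef_on_def, THEN conjunct2, THEN spec, of "\<lambda>j. x $ j"] by auto
    then show ?thesis using off by (auto simp: vec_eq_iff)
  qed
  then obtain N where N: "N ** M = mat 1"
    using matrix_left_invertible_ker[of M] by blast
  then have N': "M ** N = mat 1" using matrix_left_right_inverse by blast
  have "is_inverse_on S A (\<lambda>j l. N $ j $ l)"
    unfolding is_inverse_on_def
  proof (intro ballI conjI)
    fix j l assume jl: "j \<in> S" "l \<in> S"
    have "(\<Sum>k\<in>S. A j k * N $ k $ l) = (\<Sum>k\<in>UNIV. M $ j $ k * N $ k $ l)"
      using jl by (intro sum.mono_neutral_cong_left) (auto simp: M_def)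
    also have "\<dots> = (M ** N) $ j $ l" by (simp add: matrix_matrix_mult_def)
    finally show "(\<Sum>k\<in>S. A j k * N $ k $ l) = (if j = l then 1 else 0)"
      by (simp add: N' mat_def)
    have "(\<Sum>k\<in>S. N $ j $ k * A k l) = (\<Sum>k\<in>UNIV. N $ j $ k * M $ k $ l)"
      using jl by (intro sum.mono_neutral_cong_left) (auto simp: M_def)
    also have "\<dots> = (N ** M) $ j $ l" by (simp add: matrix_matrix_mult_def)
    finally show "(\<Sum>k\<in>S. N $ j $ k * A k l) = (if j = l then 1 else 0)"
      by (simp add: N mat_def)
  qed
  then show ?thesis by blast
qed

lemma is_inverse_on_inverse_on:
  assumes "is_inverse_on S A B"
  shows "is_inverse_on S A (inverse_on S A)"
proof -
  have "inverse_on S A = Eps (is_inverse_on S A)"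
    by (simp only: inverse_on_def is_inverse_on_def[abs_def])
  then show ?thesis using someI[where P = "is_inverse_on S A", OF assms] by simp
qed

text \<open>Transposing the inverse equations of a symmetric \<open>A\<close> shows that the
  transposed inverse is an inverse too; uniqueness on \<open>S\<close> then identifies the
  two.\<close>

lemma inverse_on_symmetric:
  fixes A :: "'n::finite \<Rightarrow> 'n \<Rightarrow> real"
  assumes "posdef_on S A" "j \<in> S" "l \<in> S"
  shows "inverse_on S A j l = inverse_on S A l j"
proof -
  let ?K = "inverse_on S A"
  have K: "is_inverse_on S A ?K"
    using posdef_on_ex_inverse[OF assms(1)] is_inverse_on_inverse_on by blast
  have s: "\<And>j l. j \<in> S \<Longrightarrow> l \<in> S \<Longrightarrow> A j l = A l j" using assms(1) unfolding posdef_on_def by blast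
  have "is_inverse_on S A (\<lambda>j l. ?K l j)"
    unfolding is_inverse_on_def
  proof (intro ballI conjI)
    fix j l assume jl: "j \<in> S" "l \<in> S"
    have "(\<Sum>k\<in>S. A j k * ?K l k) = (\<Sum>k\<in>S. ?K l k * A k j)"
      using jl s by (intro sum.cong) auto
    then show "(\<Sum>k\<in>S. A j k * ?K l k) = (if j = l then 1 else 0)"
      using K jl unfolding is_inverse_on_def by auto
    have "(\<Sum>k\<in>S. ?K k j * A k l) = (\<Sum>k\<in>S. A l k * ?K k j)"
      using jl s by (intro sum.cong) auto
    then show "(\<Sum>k\<in>S. ?K k j * A k l) = (if j = l then 1 else 0)"
      using K jl unfolding is_inverse_on_def by auto
  qed
  from is_inverse_on_unique[OF finite K this assms(2,3)] show ?thesis .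
qed

text \<open>With w = A^-1 v, the form of the inverse at \<open>v\<close> equals the form of
  \<open>A\<close> at \<open>w\<close>.\<close>

lemma inverse_on_quadratic_form_nonneg:
  fixes A :: "'n::finite \<Rightarrow> 'n \<Rightarrow> real"
  assumes "posdef_on S A"
  shows "0 \<le> (\<Sum>j\<in>S. \<Sum>l\<in>S. v j * inverse_on S A j l * v l)"
proof -
  let ?K = "inverse_on S A"
  have K: "is_inverse_on S A ?K"
    using posdef_on_ex_inverse[OF assms(1)] is_inverse_on_inverse_on by blast
  define w where "w = (\<lambda>j. \<Sum>l\<in>S. ?K j l * v l)"
  have Aw: "(\<Sum>l\<in>S. A j l * w l) = v j" if "j \<in> S" for j
  proof -
    have "(\<Sum>l\<in>S. A j l * w l) = (\<Sum>m\<in>S. (\<Sum>l\<in>S. A j l * ?K l m) * v m)"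
      unfolding w_def sum_distrib_left sum_distrib_right by (subst sum.swap) (simp add: mult.assoc)
    also have "\<dots> = (\<Sum>m\<in>S. (if j = m then 1 else 0) * v m)"
      using K that unfolding is_inverse_on_def by (intro sum.cong) auto
    finally show ?thesis using that by (simp add: if_distrib[of "\<lambda>x. x * _"] cong: if_cong)
  qed
  have "(\<Sum>j\<in>S. \<Sum>l\<in>S. v j * ?K j l * v l) = (\<Sum>j\<in>S. w j * v j)"
    by (intro sum.cong refl) (simp add: w_def sum_distrib_left mult_ac)
  also have "\<dots> = (\<Sum>j\<in>S. \<Sum>l\<in>S. w j * A j l * w l)"
    by (intro sum.cong refl) (simp add: Aw[symmetric] sum_distrib_left mult.assoc)
  also have "0 \<le> \<dots>"
  \<comment> \<open>Strict positivity is available only for vectors that do not vanish on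
    \<open>S\<close>; the other case, which includes an empty \<open>S\<close>, gives a zero
    sum.\<close>
  proof (cases "\<exists>j\<in>S. w j \<noteq> 0")
    case True
    then show ?thesis
      using assms[unfolded posdef_on_def, THEN conjunct2, THEN spec, of w] by simp
  qed (auto intro!: sum_nonneg)
  finally show ?thesis .
qed

text \<open>The matrix H^T K H, where H restricts a vector to \<open>S\<close>. Zero padding lets
  the posterior formulas be handled by ordinary matrix algebra over the whole index type.\<close>

definition embed_block :: "'n set \<Rightarrow> ('n \<Rightarrow> 'n \<Rightarrow> real) \<Rightarrow> real^'n^'n" where
  "embed_block S K = (\<chi> a b. if a \<in> S \<and> b \<in> S then K a b else 0)"

text \<open>The padded residual H^T (y - H x).\<close>

definition obs_residual :: "'n set \<Rightarrow> real^'n \<Rightarrow> ('n \<Rightarrow> real) \<Rightarrow> real^'n" where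
  "obs_residual S x y = (\<chi> l. if l \<in> S then y l - x $ l else 0)"

lemma obs_row_nth: "obs_row j $ a = (if j = a then 1 else 0)"
  by (simp add: obs_row_def axis_def)

lemma inner_obs_row: "obs_row j \<bullet> x = x $ j"
  by (simp add: obs_row_def inner_axis')

lemma embed_block_vec: "(embed_block S K *v x) $ j = (if j \<in> S then \<Sum>l\<in>S. K j l * x $ l else 0)"
proof (cases "j \<in> S")
  case True
  have "(embed_block S K *v x) $ j = (\<Sum>l\<in>UNIV. embed_block S K $ j $ l * x $ l)"
    by (simp add: matrix_vector_mult_def)
  also have "\<dots> = (\<Sum>l\<in>S. K j l * x $ l)"
    using True by (intro sum.mono_neutral_cong_right) (auto simp: embed_block_def)
  finally show ?thesis using True by simp
qed (simp add: embed_block_def matrix_vector_mult_def)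

lemma inner_embed_block:
  "x \<bullet> (embed_block S K *v x) = (\<Sum>j\<in>S. \<Sum>l\<in>S. x $ j * K j l * x $ l)"
proof -
  have "x \<bullet> (embed_block S K *v x) = (\<Sum>j\<in>UNIV. x $ j * (embed_block S K *v x) $ j)"
    by (simp add: inner_vec_def)
  also have "\<dots> = (\<Sum>j\<in>S. x $ j * (embed_block S K *v x) $ j)"
    by (rule sum.mono_neutral_right) (auto simp: embed_block_vec)
  finally show ?thesis by (simp add: embed_block_vec sum_distrib_left mult.assoc)
qed

lemma post_precision_embed_block: "post_precision Q S R = Q + embed_block S (inverse_on S R)"
proof -
  have "(\<Sum>j\<in>S. \<Sum>l\<in>S. obs_row j $ a * K j l * obs_row l $ b) = embed_block S K $ a $ b" for a b and K :: "'a \<Rightarrow> 'a \<Rightarrow> real"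
    by (cases "a \<in> S"; cases "b \<in> S")
       (simp_all add: obs_row_nth embed_block_def if_distrib[of "\<lambda>x. _ * x"] if_distrib[of "\<lambda>x. x * _"]
         sum.If_cases cong: if_cong)
  then show ?thesis unfolding post_precision_def by (simp add: vec_eq_iff)
qed

text \<open>Since H H^T is the identity on \<open>S\<close>-indexed vectors, H^T K (y - H x) equals
  (H^T K H) applied to the padded residual.\<close>

lemma post_mean_embed_block:
  "post_mean Q S R x y = post_cov Q S R *v (embed_block S (inverse_on S R) *v obs_residual S x y)"
proof -
  have *: "(\<Sum>j\<in>S. (\<Sum>l\<in>S. K j l * (y l - obs_row l \<bullet> x)) *\<^sub>R obs_row j) $ a
      = (embed_block S K *v obs_residual S x y) $ a" for a and K :: "'a \<Rightarrow> 'a \<Rightarrow> real"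
  proof -
    have "(\<Sum>j\<in>S. (\<Sum>l\<in>S. K j l * (y l - obs_row l \<bullet> x)) *\<^sub>R obs_row j) $ a
      = (\<Sum>j\<in>S. if j = a then \<Sum>l\<in>S. K a l * (y l - x $ l) else 0)"
      by (simp only: sum_component vector_scaleR_component inner_obs_row)
         (intro sum.cong; simp add: obs_row_nth)
    then show ?thesis by (simp add: embed_block_vec obs_residual_def)
  qed
  show ?thesis unfolding post_mean_def
    by (rule arg_cong[where f="(*v) _"]) (rule iffD2[OF vec_eq_iff], rule allI, rule *)
qed

lemma posdef_post_precision:
  assumes "posdef Q" "posdef_on S R"
  shows "posdef (post_precision Q S R)"
  unfolding post_precision_embed_block
proof (rule posdef_add_psd[OF assms(1)])
  show "transpose (embed_block S (inverse_on S R)) = embed_block S (inverse_on S R)"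
    using inverse_on_symmetric[OF assms(2)] by (simp add: transpose_def vec_eq_iff embed_block_def)
  show "0 \<le> v \<bullet> (embed_block S (inverse_on S R) *v v)" for v
    unfolding inner_embed_block by (rule inverse_on_quadratic_form_nonneg[OF assms(2)])
qed

section \<open>Adding one observation\<close>

text \<open>The block diagonal candidate satisfies the inverse equations, and inverses are unique on
  \<open>insert i S\<close>.\<close>

lemma inverse_on_extend_cov:
  fixes R :: "'n::finite \<Rightarrow> 'n \<Rightarrow> real"
  assumes "posdef_on S R" "i \<notin> S" "s \<noteq> 0" "j \<in> insert i S" "l \<in> insert i S"
  shows "inverse_on (insert i S) (extend_cov S R i s) j l
    = (if j \<in> S \<and> l \<in> S then inverse_on S R j l else if j = i \<and> l = i then 1 / s else 0)"
proof -
  let ?B = "\<lambda>j l. if j \<in> S \<and> l \<in> S then inverse_on S R j l else if j = i \<and> l = i then 1 / s else 0"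
  have K: "is_inverse_on S R (inverse_on S R)"
    using posdef_on_ex_inverse[OF assms(1)] is_inverse_on_inverse_on by blast
  have B: "is_inverse_on (insert i S) (extend_cov S R i s) ?B"
    unfolding is_inverse_on_def
  proof (intro ballI)
    fix j l assume jl: "j \<in> insert i S" "l \<in> insert i S"
    have e: "(\<Sum>k\<in>insert i S. f k) = f i + sum f S" for f :: "'n \<Rightarrow> real"
      using assms(2) by simp
    \<comment> \<open>Mixed blocks vanish, so the part of the product summed over \<open>S\<close>
      is the identity on the \<open>S\<close>-block and zero elsewhere; the index \<open>i\<close>
      supplies the remaining diagonal entry.\<close>
    have 1: "(\<Sum>k\<in>S. extend_cov S R i s j k * ?B k l) = (if j \<in> S \<and> l \<in> S then if j = l then 1 else 0 else 0)"
    proof -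
      have "(\<Sum>k\<in>S. extend_cov S R i s j k * ?B k l) = (\<Sum>k\<in>S. if j \<in> S \<and> l \<in> S then R j k * inverse_on S R k l else 0)"
        using assms(2) jl by (intro sum.cong) (auto simp: extend_cov_def)
      then show ?thesis using K unfolding is_inverse_on_def by auto
    qed
    have 2: "(\<Sum>k\<in>S. ?B j k * extend_cov S R i s k l) = (if j \<in> S \<and> l \<in> S then if j = l then 1 else 0 else 0)"
    proof -
      have "(\<Sum>k\<in>S. ?B j k * extend_cov S R i s k l) = (\<Sum>k\<in>S. if j \<in> S \<and> l \<in> S then inverse_on S R j k * R k l else 0)"
        using assms(2) jl by (intro sum.cong) (auto simp: extend_cov_def)
      then show ?thesis using K unfolding is_inverse_on_def by auto
    qed
    show "(\<Sum>k\<in>insert i S. extend_cov S R i s j k * ?B k l) = (if j = l then 1 else 0) \<and>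
          (\<Sum>k\<in>insert i S. ?B j k * extend_cov S R i s k l) = (if j = l then 1 else 0)"
      unfolding e 1 2 using assms(2,3) jl by (auto simp: extend_cov_def)
  qed
  show ?thesis
    using is_inverse_on_unique[OF _ is_inverse_on_inverse_on[OF B] B assms(4,5)] by simp
qed

text \<open>Column \<open>i\<close> of the covariance divided by the variance of the innovation, for
  a scalar measurement of coordinate \<open>i\<close> with noise variance \<open>s\<close>.\<close>

definition kalman_gain :: "real^'n^'n \<Rightarrow> real \<Rightarrow> 'n \<Rightarrow> real^'n" where
  "kalman_gain \<Sigma> s i = (1 / (s + \<Sigma> $ i $ i)) *\<^sub>R (\<Sigma> *v axis i 1)"

context
  fixes Q :: "real^'n^'n" and S :: "'n set" and R :: "'n \<Rightarrow> 'n \<Rightarrow> real" and i :: 'n and s :: real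
  assumes Q: "posdef Q" and R: "posdef_on S R" and i: "i \<notin> S" and s: "0 < s"
begin

text \<open>A new point observation adds the rank-one matrix e_i e_i^T / s. Recording its action on
  vectors makes the later updates vector identities.\<close>

lemma embed_block_extend_cov_vec:
  "embed_block (insert i S) (inverse_on (insert i S) (extend_cov S R i s)) *v x
    = embed_block S (inverse_on S R) *v x + (x $ i / s) *\<^sub>R axis i 1"
proof -
  have "(embed_block (insert i S) (inverse_on (insert i S) (extend_cov S R i s)) *v x) $ j
    = (embed_block S (inverse_on S R) *v x + (x $ i / s) *\<^sub>R axis i 1) $ j" for j
  proof -
    have "(embed_block (insert i S) (inverse_on (insert i S) (extend_cov S R i s)) *v x) $ j
      = (if j \<in> insert i S then
         \<Sum>l\<in>insert i S. (if j \<in> S \<and> l \<in> S then inverse_on S R j l else if j = i \<and> l = i then 1 / s else 0) * x $ l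
         else 0)"
      unfolding embed_block_vec using inverse_on_extend_cov[OF R i] s
      by (intro if_cong refl sum.cong arg_cong2[where f="(*)"]) auto
    also have "\<dots> = (embed_block S (inverse_on S R) *v x + (x $ i / s) *\<^sub>R axis i 1) $ j"
      using i by (auto simp: embed_block_vec axis_def intro!: sum.neutral)
    finally show ?thesis .
  qed
  then show ?thesis by (simp add: vec_eq_iff)
qed

lemma post_precision_extend_cov_vec:
  "post_precision Q (insert i S) (extend_cov S R i s) *v x
    = post_precision Q S R *v x + (x $ i / s) *\<^sub>R axis i 1"
  unfolding post_precision_embed_block
  by (simp add: matrix_vector_mult_add_rdistrib embed_block_extend_cov_vec)

text \<open>The old precision is positive definite and the rank-one increment is positive
  semidefinite because \<open>s\<close> is positive.\<close>

lemma posdef_post_precision_extend_cov: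
  "posdef (post_precision Q (insert i S) (extend_cov S R i s))"
proof -
  let ?E = "\<chi> a b. if a = i \<and> b = i then 1 / s else (0 :: real)"
  have Ev: "?E *v x = (x $ i / s) *\<^sub>R axis i 1" for x
    by (simp add: vec_eq_iff matrix_vector_mult_def axis_def if_distrib[of "\<lambda>x. x * _"] cong: if_cong)
  have "post_precision Q (insert i S) (extend_cov S R i s) = post_precision Q S R + ?E"
    unfolding matrix_eq
    by (simp only: post_precision_extend_cov_vec matrix_vector_mult_add_rdistrib Ev) simp
  moreover have "posdef (post_precision Q S R + ?E)"
  proof (rule posdef_add_psd[OF posdef_post_precision[OF Q R]])
    show "transpose ?E = ?E" by (auto simp: transpose_def vec_eq_iff)
    show "0 \<le> v \<bullet> (?E *v v)" for v
      unfolding Ev using s by (simp add: inner_axis)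
  qed
  ultimately show ?thesis by simp
qed

lemma post_cov_diag_pos: "0 < post_cov Q S R $ i $ i"
proof -
  have "posdef (post_cov Q S R)"
    unfolding post_cov_def by (intro posdef_matrix_inv_posdef posdef_post_precision Q R)
  then have "0 < axis i 1 \<bullet> (post_cov Q S R *v axis i 1)"
    unfolding posdef_def by (simp add: axis_eq_0_iff)
  then show ?thesis
    by (simp add: inner_axis' matrix_vector_mult_basis column_def)
qed

text \<open>Equivalently, the gain is the new covariance applied to e_i / s. The old precision
  contributes 1 and the rank-one term \<open>?p / s\<close>, both over \<open>s + ?p\<close>, and
  these add up to 1 / s. Both update formulas below can thus be verified by multiplying with the new
  precision.\<close>

lemma post_precision_kalman_gain:
  "post_precision Q (insert i S) (extend_cov S R i s) *v kalman_gain (post_cov Q S R) s i = (1 / s) *\<^sub>R axis i 1"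
proof -
  let ?p = "post_cov Q S R $ i $ i"
  have "post_precision Q S R *v (post_cov Q S R *v axis i 1) = axis i 1"
    unfolding post_cov_def by (rule matrix_inv_vec[OF posdef_post_precision[OF Q R]])
  moreover have "(post_cov Q S R *v axis i 1) $ i = ?p"
    by (simp add: matrix_vector_mult_basis column_def)
  ultimately have "post_precision Q (insert i S) (extend_cov S R i s) *v kalman_gain (post_cov Q S R) s i
    = (1 / (s + ?p) + ?p / (s + ?p) / s) *\<^sub>R axis i 1"
    unfolding post_precision_extend_cov_vec kalman_gain_def
    by (simp add: matrix_vector_mult_scaleR scaleR_add_left)
  also have "1 / (s + ?p) + ?p / (s + ?p) / s = 1 / s"
    using s post_cov_diag_pos by (simp add: divide_simps add_nonneg_eq_0_iff)
  finally show ?thesis .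
qed

text \<open>The claimed vector solves the normal equations of the enlarged observation set, whose
  matrix is invertible.\<close>

lemma post_mean_extend:
  "post_mean Q (insert i S) (extend_cov S R i s) x y =
     post_mean Q S R x y + (y i - x $ i - post_mean Q S R x y $ i) *\<^sub>R kalman_gain (post_cov Q S R) s i"
proof -
  let ?A = "post_precision Q S R" and ?A1 = "post_precision Q (insert i S) (extend_cov S R i s)"
  let ?m = "post_mean Q S R x y" and ?k = "kalman_gain (post_cov Q S R) s i"
  let ?K = "embed_block S (inverse_on S R)"
  have "?A *v ?m = ?K *v obs_residual S x y"
    unfolding post_mean_embed_block post_cov_def by (rule matrix_inv_vec[OF posdef_post_precision[OF Q R]])
  \<comment> \<open>The old block has a zero column at \<open>i\<close>, so it does not see the new
    residual entry.\<close>
  moreover have "?K *v obs_residual (insert i S) x y = ?K *v obs_residual S x y"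
    using i by (auto simp: vec_eq_iff embed_block_vec obs_residual_def intro!: sum.cong)
  moreover have "?A1 *v (?m + (y i - x $ i - ?m $ i) *\<^sub>R ?k)
      = ?A *v ?m + (?m $ i / s) *\<^sub>R axis i 1 + (y i - x $ i - ?m $ i) *\<^sub>R (1 / s) *\<^sub>R axis i 1"
    by (simp only: matrix_vector_right_distrib matrix_vector_mult_scaleR post_precision_kalman_gain)
       (simp only: post_precision_extend_cov_vec)
  \<comment> \<open>The predicted value \<open>?m $ i\<close> cancels against the one inside the
    innovation, leaving exactly the contribution of the new observation to the right-hand
    side.\<close>
  moreover have "(?m $ i / s) *\<^sub>R axis i 1 + (y i - x $ i - ?m $ i) *\<^sub>R (1 / s) *\<^sub>R axis i 1
      = ((y i - x $ i) / s) *\<^sub>R (axis i 1 :: real^'n)"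
    by (simp add: scaleR_add_left[symmetric] diff_divide_distrib)
  ultimately have "?A1 *v (?m + (y i - x $ i - ?m $ i) *\<^sub>R ?k)
      = embed_block (insert i S) (inverse_on (insert i S) (extend_cov S R i s)) *v obs_residual (insert i S) x y"
    unfolding embed_block_extend_cov_vec by (simp add: add.assoc) (simp add: obs_residual_def)
  then show ?thesis
    unfolding post_mean_embed_block[of Q "insert i S"] post_cov_def[of Q "insert i S"]
    using matrix_inv_vec(2)[OF posdef_post_precision_extend_cov] by metis
qed

text \<open>The Sherman-Morrison formula, verified by multiplication with the new precision: the
  rank-one term and the gain correction cancel.\<close>

lemma post_cov_extend_vec:
  "post_cov Q (insert i S) (extend_cov S R i s) *v x
    = post_cov Q S R *v x - ((post_cov Q S R *v x) $ i) *\<^sub>R kalman_gain (post_cov Q S R) s i"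
proof -
  let ?A1 = "post_precision Q (insert i S) (extend_cov S R i s)"
  have "post_precision Q S R *v (post_cov Q S R *v x) = x"
    unfolding post_cov_def by (rule matrix_inv_vec[OF posdef_post_precision[OF Q R]])
  then have "?A1 *v (post_cov Q S R *v x - ((post_cov Q S R *v x) $ i) *\<^sub>R kalman_gain (post_cov Q S R) s i) = x"
    by (simp only: matrix_vector_mult_diff_distrib matrix_vector_mult_scaleR post_precision_kalman_gain)
       (simp add: post_precision_extend_cov_vec)
  then show ?thesis
    unfolding post_cov_def[of Q "insert i S"]
    using matrix_inv_vec(2)[OF posdef_post_precision_extend_cov] by metis
qed

text \<open>The covariance decreases by the outer product of the gain with column \<open>i\<close>,
  so the trace of its product with the diagonal weight is a weighted inner product.\<close>

lemma utility_kalman_gain: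
  "utility (diag_matrix w) Q S R s i
    = (diag_matrix w *v kalman_gain (post_cov Q S R) s i) \<bullet> (post_cov Q S R *v axis i 1)"
proof -
  let ?P = "post_cov Q S R" and ?k = "kalman_gain (post_cov Q S R) s i"
  have col: "(M *v axis b 1) $ a = M $ a $ b" for M :: "real^'n^'n" and a b
    by (simp add: matrix_vector_mult_basis column_def)
  have "transpose ?P = ?P"
    unfolding post_cov_def by (rule posdef_matrix_inv(3)[OF posdef_post_precision[OF Q R]])
  then have "transpose ?P $ i $ a = ?P $ i $ a" for a
    by simp
  then have sym: "?P $ a $ i = ?P $ i $ a" for a
    by (simp add: transpose_def)
  have tr: "trace (diag_matrix w ** M) = (\<Sum>a\<in>UNIV. w $ a * M $ a $ a)" for M :: "real^'n^'n"
    by (simp add: trace_def matrix_matrix_mult_def diag_matrix_def if_distrib[of "\<lambda>x. x * _"] cong: if_cong)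
  have "post_cov Q (insert i S) (extend_cov S R i s) $ a $ a = ?P $ a $ a - ?P $ i $ a * ?k $ a" for a
    by (subst col[symmetric]) (simp add: post_cov_extend_vec col)
  then have "utility (diag_matrix w) Q S R s i = (\<Sum>a\<in>UNIV. w $ a * (?P $ i $ a * ?k $ a))"
    unfolding utility_def tr by (simp add: sum_subtractf[symmetric] right_diff_distrib[symmetric])
  also have "\<dots> = (diag_matrix w *v ?k) \<bullet> (?P *v axis i 1)"
    unfolding inner_vec_def diag_matrix_vec col sym by (simp add: mult_ac)
  finally show ?thesis .
qed

end

section \<open>Lebesgue measure on coordinate spaces\<close>

lemma borel_measurable_vec_nth_component [measurable]:
  "(\<lambda>x :: real^'n. x $ j) \<in> borel_measurable borel"
  by (intro borel_measurable_continuous_onI continuous_intros)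

lemma borel_measurable_matrix_vector [measurable (raw)]:
  fixes A :: "real^'n^'m"
  assumes "f \<in> borel_measurable M"
  shows "(\<lambda>x. A *v f x) \<in> borel_measurable M"
proof -
  have "(*v) A \<in> borel_measurable borel"
    by (intro borel_measurable_continuous_onI linear_continuous_on) (auto simp: linear_linear)
  then show ?thesis using assms by (rule measurable_compose[rotated])
qed

lemma vec_lambda_axis_sum: "(\<chi> j. v j) = (\<Sum>j\<in>UNIV. v j *\<^sub>R (axis j 1 :: real^'n))"
  by (simp add: vec_eq_iff axis_def if_distrib[of "\<lambda>x. _ * x"] cong: if_cong)

lemma borel_measurable_vec_lambda [measurable (raw)]:
  assumes "\<And>j. (\<lambda>x. f x j) \<in> borel_measurable M"
  shows "(\<lambda>x. (\<chi> j. f x j) :: real^'n) \<in> borel_measurable M"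
  unfolding vec_lambda_axis_sum using assms by (intro borel_measurable_sum borel_measurable_scaleR) auto

text \<open>The Gaussian hypotheses give densities on a product of lines, whereas the moments are
  computed on \<open>real^'n\<close>. Boxes determine Lebesgue measure, and both measures give a box
  the product of its side lengths.\<close>

lemma lborel_vec:
  "distr (PiM UNIV (\<lambda>_. lborel)) borel vec_lambda = (lborel :: (real^'n) measure)"
proof (rule lborel_eqI[symmetric])
  interpret product_sigma_finite "\<lambda>_ :: 'n. lborel :: real measure"
    by standard
  have [measurable]: "(vec_lambda :: ('n \<Rightarrow> real) \<Rightarrow> real^'n) \<in> borel_measurable (PiM UNIV (\<lambda>_. lborel))"
    by (rule borel_measurable_vec_lambda) simp
  have B: "(Basis :: (real^'n) set) = (\<lambda>j. axis j 1) ` UNIV"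
    by (auto simp: Basis_vec_def)
  fix l u :: "real^'n" assume le: "\<And>b. b \<in> Basis \<Longrightarrow> l \<bullet> b \<le> u \<bullet> b"
  have le': "l $ j \<le> u $ j" for j
    using le[of "axis j 1"] by (simp add: inner_axis)
  have "vec_lambda -` box l u \<inter> space (PiM UNIV (\<lambda>_. lborel)) = (\<Pi>\<^sub>E j\<in>UNIV. {l $ j<..<u $ j})"
    by (auto simp: mem_box_cart space_PiM PiE_iff)
  then have "emeasure (distr (PiM UNIV (\<lambda>_. lborel)) borel vec_lambda) (box l u)
      = (\<Prod>j\<in>UNIV. ennreal (u $ j - l $ j))"
    by (simp add: emeasure_distr emeasure_PiM le')
  also have "\<dots> = ennreal (\<Prod>j\<in>UNIV. u $ j - l $ j)"
    by (rule prod_ennreal) (simp add: le')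
  also have "(\<Prod>j\<in>UNIV. u $ j - l $ j) = (\<Prod>b\<in>Basis. (u - l) \<bullet> b)"
    unfolding B by (subst prod.reindex) (auto simp: inj_on_def axis_eq_axis inner_axis)
  finally show "emeasure (distr (PiM UNIV (\<lambda>_. lborel)) borel vec_lambda) (box l u)
      = (\<Prod>b\<in>Basis. (u - l) \<bullet> b)" .
qed simp

lemma distributed_vec:
  fixes X :: "'w \<Rightarrow> real^'n"
  assumes D: "distributed P (PiM UNIV (\<lambda>_. lborel)) (\<lambda>\<omega> j. X \<omega> $ j) (\<lambda>v. f (vec_lambda v))"
    and [measurable]: "f \<in> borel_measurable borel"
  shows "distributed P lborel X f"
proof -
  let ?L = "PiM UNIV (\<lambda>_ :: 'n. lborel :: real measure)"
  have v[measurable]: "(vec_lambda :: ('n \<Rightarrow> real) \<Rightarrow> real^'n) \<in> borel_measurable ?L"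
    by (rule borel_measurable_vec_lambda) simp
  have X[measurable]: "(\<lambda>\<omega> j. X \<omega> $ j) \<in> measurable P ?L"
    using D by (simp add: distributed_def)
  have X': "X = vec_lambda \<circ> (\<lambda>\<omega> j. X \<omega> $ j)"
    by (auto simp: fun_eq_iff)
  have "X \<in> measurable P borel"
    by (subst X') (rule measurable_comp[OF X v])
  have "distr P borel X = distr (distr P ?L (\<lambda>\<omega> j. X \<omega> $ j)) borel vec_lambda"
    by (subst distr_distr[OF v X]) (simp add: X'[symmetric])
  also have "\<dots> = distr (density ?L (\<lambda>v. f (vec_lambda v))) borel vec_lambda"
    using D by (simp add: distributed_def)
  also have "\<dots> = density (distr ?L borel vec_lambda) f"
    by (rule density_distr[symmetric]) auto
  finally have "distr P borel X = density lborel f"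
    by (simp add: lborel_vec)
  moreover have "distr P lborel X = distr P borel X"
    by (rule distr_cong) auto
  ultimately show ?thesis
    using \<open>X \<in> measurable P borel\<close> unfolding distributed_def by simp
qed

section \<open>Translation invariance of Lebesgue measure\<close>

lemma nn_integral_lborel_translate:
  fixes f :: "'a::euclidean_space \<Rightarrow> ennreal"
  assumes [measurable]: "f \<in> borel_measurable borel"
  shows "(\<integral>\<^sup>+x. f (c + x) \<partial>lborel) = (\<integral>\<^sup>+x. f x \<partial>lborel)"
proof -
  have "(\<integral>\<^sup>+x. f x \<partial>lborel) = (\<integral>\<^sup>+x. f x \<partial>distr lborel borel ((+) c))"
    by (simp add: lborel_distr_plus)
  also have "\<dots> = (\<integral>\<^sup>+x. f (c + x) \<partial>lborel)"
    by (rule nn_integral_distr) auto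
  finally show ?thesis by simp
qed

text \<open>On rectangles this is one-dimensional translation invariance in each coordinate. The
  shifted function is restricted to \<open>S\<close> because points of the product space are
  \<open>undefined\<close> elsewhere.\<close>

lemma distr_PiM_lborel_translate:
  fixes c :: "'i \<Rightarrow> real"
  assumes "finite S"
  shows "distr (PiM S (\<lambda>_. lborel)) (PiM S (\<lambda>_. lborel)) (\<lambda>v. \<lambda>j\<in>S. c j + v j) = PiM S (\<lambda>_. lborel)"
proof -
  interpret product_sigma_finite "\<lambda>_ :: 'i. lborel :: real measure"
    by standard
  have m[measurable]: "(\<lambda>v. \<lambda>j\<in>S. c j + v j) \<in> measurable (PiM S (\<lambda>_. lborel)) (PiM S (\<lambda>_. lborel))"
    by measurable
  show ?thesis
  proof (rule PiM_eqI[OF assms])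
    fix A :: "'i \<Rightarrow> real set" assume A: "\<And>i. i \<in> S \<Longrightarrow> A i \<in> sets lborel"
    have tr: "emeasure lborel ((+) (c i) -` A i) = emeasure lborel (A i)" if "i \<in> S" for i
    proof -
      have "emeasure lborel (A i) = emeasure (distr lborel borel ((+) (c i))) (A i)"
        by (simp add: lborel_distr_plus)
      also have "\<dots> = emeasure lborel ((+) (c i) -` A i)"
        using A[OF that] by (subst emeasure_distr) auto
      finally show ?thesis by simp
    qed
    have sets: "(+) (c i) -` A i \<in> sets lborel" if "i \<in> S" for i
    proof -
      have "(+) (c i) -` A i \<inter> space borel \<in> sets borel"
        using A[OF that] by (intro measurable_sets[of _ borel borel]) auto
      then show ?thesis by simp
    qed
    have "(\<lambda>v. \<lambda>j\<in>S. c j + v j) -` Pi\<^sub>E S A \<inter> space (PiM S (\<lambda>_. lborel)) = (\<Pi>\<^sub>E i\<in>S. (+) (c i) -` A i)"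
      by (auto simp: space_PiM PiE_iff)
    then show "emeasure (distr (PiM S (\<lambda>_. lborel)) (PiM S (\<lambda>_. lborel)) (\<lambda>v. \<lambda>j\<in>S. c j + v j)) (Pi\<^sub>E S A)
        = (\<Prod>i\<in>S. emeasure lborel (A i))"
      using A assms emeasure_PiM[OF assms sets] prod.cong[OF refl tr, of S "\<lambda>i. i"]
      by (subst emeasure_distr[OF m]) (auto intro!: sets_PiM_I_finite)
  qed simp
qed

lemma nn_integral_PiM_lborel_translate:
  fixes c :: "'i \<Rightarrow> real"
  assumes "finite S" and [measurable]: "f \<in> borel_measurable (PiM S (\<lambda>_. lborel))"
  shows "(\<integral>\<^sup>+v. f (\<lambda>j\<in>S. c j + v j) \<partial>PiM S (\<lambda>_. lborel)) = (\<integral>\<^sup>+v. f v \<partial>PiM S (\<lambda>_. lborel))"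
proof -
  have "(\<integral>\<^sup>+v. f v \<partial>PiM S (\<lambda>_. lborel)) =
      (\<integral>\<^sup>+v. f v \<partial>distr (PiM S (\<lambda>_. lborel)) (PiM S (\<lambda>_. lborel)) (\<lambda>v. \<lambda>j\<in>S. c j + v j))"
    by (simp add: distr_PiM_lborel_translate[OF assms(1)])
  also have "\<dots> = (\<integral>\<^sup>+v. f (\<lambda>j\<in>S. c j + v j) \<partial>PiM S (\<lambda>_. lborel))"
    by (rule nn_integral_distr) auto
  finally show ?thesis by simp
qed

section \<open>Moments of Gaussian vectors\<close>

text \<open>The expression factors as (exp z - 1) (1 - exp (-z)), and for nonnegative z the factors
  are at most z exp z and z. It is even in z, which covers the other sign. The bound feeds the
  dominated convergence for second moments.\<close>

lemma second_difference_exp_bound: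
  fixes z :: real
  shows "0 \<le> exp z + exp (-z) - 2" "exp z + exp (-z) - 2 \<le> z\<^sup>2 * exp \<bar>z\<bar>"
proof -
  have e: "exp z + exp (-z) - 2 = (exp z - 1) * (1 - exp (-z))" for z :: real
    by (simp add: algebra_simps flip: exp_add)
  have pos: "0 \<le> exp z + exp (-z) - 2 \<and> exp z + exp (-z) - 2 \<le> z\<^sup>2 * exp z" if "0 \<le> z" for z :: real
  proof -
    have 1: "1 - exp (-z) \<le> z" using exp_ge_add_one_self[of "-z"] by simp
    have "exp z - 1 = exp z * (1 - exp (-z))" by (simp add: algebra_simps flip: exp_add)
    also have "\<dots> \<le> exp z * z" using 1 by (intro mult_left_mono) auto
    finally have "(exp z - 1) * (1 - exp (-z)) \<le> exp z * z * z"
      using 1 that by (intro mult_mono) auto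
    then show ?thesis unfolding e using that by (auto simp: power2_eq_square mult_ac)
  qed
  show "0 \<le> exp z + exp (-z) - 2" "exp z + exp (-z) - 2 \<le> z\<^sup>2 * exp \<bar>z\<bar>"
    using pos[of z] pos[of "-z"] by (cases "0 \<le> z"; auto simp: add.commute)+
qed

lemma sq_le_two_exp_abs: "(x::real)\<^sup>2 \<le> 2 * exp \<bar>x\<bar>"
  using exp_lower_Taylor_quadratic[of "\<bar>x\<bar>"] by simp

context prob_space
begin

text \<open>The mean comes from the tangent inequality 1 + t Y \<le> exp (t Y) as t tends to 0, the
  second moment from the limit of symmetric second differences. Degenerate \<open>Y\<close> with
  \<open>s = 0\<close> is included, as it occurs for the zero direction below.\<close>

lemma moments_of_gaussian_mgf:
  fixes Y :: "'a \<Rightarrow> real"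
  assumes [measurable]: "Y \<in> borel_measurable M"
    and mgf: "\<And>t. (\<integral>\<^sup>+\<omega>. ennreal (exp (t * Y \<omega>)) \<partial>M) = ennreal (exp (t\<^sup>2 * s / 2))"
  shows "integrable M Y" "expectation Y = 0"
    "integrable M (\<lambda>\<omega>. (Y \<omega>)\<^sup>2)" "expectation (\<lambda>\<omega>. (Y \<omega>)\<^sup>2) = s"
proof -
  have int: "integrable M (\<lambda>\<omega>. exp (t * Y \<omega>))" for t
    by (rule integrableI_nonneg) (auto simp: mgf)
  have E: "expectation (\<lambda>\<omega>. exp (t * Y \<omega>)) = exp (t\<^sup>2 * s / 2)" for t
    by (subst integral_eq_nn_integral) (auto simp: mgf)
  have int': "integrable M (\<lambda>\<omega>. exp (Y \<omega>))" "integrable M (\<lambda>\<omega>. exp (- Y \<omega>))"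
    using int[of 1] int[of "-1"] by simp_all
  show iY: "integrable M Y"
  proof (rule Bochner_Integration.integrable_bound[OF Bochner_Integration.integrable_add[OF int']])
    have "\<bar>y\<bar> \<le> exp y + exp (-y)" for y :: real
      using exp_ge_add_one_self[of y] exp_ge_add_one_self[of "-y"] exp_gt_zero[of y] exp_gt_zero[of "-y"]
      by (cases "0 \<le> y") linarith+
    then show "AE \<omega> in M. norm (Y \<omega>) \<le> norm (exp (Y \<omega>) + exp (- Y \<omega>))"
      by (intro AE_I2) (simp add: add_nonneg_nonneg)
  qed simp
  have mean_le: "t * expectation Y \<le> exp (t\<^sup>2 * s / 2) - 1" for t
  proof -
    have "t * expectation Y + 1 = expectation (\<lambda>\<omega>. t * Y \<omega> + 1)"
      using iY by (simp add: prob_space)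
    also have "\<dots> \<le> expectation (\<lambda>\<omega>. exp (t * Y \<omega>))"
      using iY int by (intro integral_mono) (auto simp: add.commute[of _ 1])
    finally show ?thesis by (simp add: E)
  qed
  have lim0: "((\<lambda>t. (exp (t\<^sup>2 * s / 2) - 1) / t) \<longlongrightarrow> 0) (at_right 0)"
    by real_asymp
  \<comment> \<open>Dividing by t and letting t decrease to 0 bounds the mean above by 0; negative t
    gives the same bound for its negative.\<close>
  have "a \<le> 0" if "\<And>t. 0 < t \<Longrightarrow> t * a \<le> exp (t\<^sup>2 * s / 2) - 1" for a
  proof (rule tendsto_lowerbound[OF lim0])
    show "\<forall>\<^sub>F t in at_right 0. a \<le> (exp (t\<^sup>2 * s / 2) - 1) / t"
      using that eventually_at_right_less[of "0::real"]
      by (auto elim!: eventually_mono simp: pos_le_divide_eq mult.commute)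
  qed simp
  from this[of "expectation Y"] this[of "- expectation Y"] show "expectation Y = 0"
    using mean_le mean_le[of "- t" for t] by (metis eq_iff minus_mult_minus minus_mult_commute neg_le_0_iff_le power2_minus)
  \<comment> \<open>Second difference quotients with step 1 / (n + 1), which converge pointwise to
    the square of \<open>Y\<close>; \<open>Suc n\<close> avoids a zero denominator. The function
    \<open>?w\<close> dominates all of them.\<close>
  let ?f = "\<lambda>n \<omega>. (exp (1 / real (Suc n) * Y \<omega>) + exp (- (1 / real (Suc n)) * Y \<omega>) - 2) * (real (Suc n))\<^sup>2"
  let ?w = "\<lambda>\<omega>. 2 * (exp (2 * Y \<omega>) + exp (-2 * Y \<omega>))"
  have wint: "integrable M ?w"
    by (intro Bochner_Integration.integrable_add integrable_mult_right int)
  have lim: "(\<lambda>n. (exp (1 / real (Suc n) * y) + exp (- (1 / real (Suc n)) * y) - 2) * (real (Suc n))\<^sup>2) \<longlonglongrightarrow> y\<^sup>2" for y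
    unfolding power2_eq_square[of y] by real_asymp
  have bound: "norm ((exp (1 / real (Suc n) * y) + exp (- (1 / real (Suc n)) * y) - 2) * (real (Suc n))\<^sup>2)
      \<le> 2 * (exp (2 * y) + exp (-2 * y))" for y n
  proof -
    let ?z = "1 / real (Suc n) * y"
    have zy: "\<bar>?z\<bar> \<le> \<bar>y\<bar>"
      using mult_left_mono[of 1 "1 + real n" "\<bar>y\<bar>"] by (simp add: abs_mult divide_simps)
    have "norm ((exp ?z + exp (- (1 / real (Suc n)) * y) - 2) * (real (Suc n))\<^sup>2)
      = (exp ?z + exp (- ?z) - 2) * (real (Suc n))\<^sup>2"
      using second_difference_exp_bound(1)[of ?z] by (simp add: abs_mult)
    also have "\<dots> \<le> (?z\<^sup>2 * exp \<bar>?z\<bar>) * (real (Suc n))\<^sup>2"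
      by (intro mult_right_mono second_difference_exp_bound) auto
    also have "\<dots> = (?z * real (Suc n))\<^sup>2 * exp \<bar>?z\<bar>"
      by (simp only: power_mult_distrib mult_ac)
    also have "\<dots> = y\<^sup>2 * exp \<bar>?z\<bar>"
      by simp
    \<comment> \<open>One factor exp |y| absorbs the square, the other bounds exp |z| uniformly in
      n.\<close>
    also have "\<dots> \<le> (2 * exp \<bar>y\<bar>) * exp \<bar>y\<bar>"
      using zy by (intro mult_mono sq_le_two_exp_abs) auto
    also have "\<dots> = 2 * exp (2 * \<bar>y\<bar>)"
      by (simp flip: exp_add)
    also have "\<dots> \<le> 2 * (exp (2 * y) + exp (-2 * y))"
      by (cases "0 \<le> y") (auto simp: abs_if)
    finally show ?thesis .
  qed
  show "integrable M (\<lambda>\<omega>. (Y \<omega>)\<^sup>2)"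
    by (rule integrable_dominated_convergence[where s = ?f and w = ?w])
       (use wint lim bound in auto)
  have "(\<lambda>n. expectation (?f n)) \<longlonglongrightarrow> expectation (\<lambda>\<omega>. (Y \<omega>)\<^sup>2)"
    by (rule integral_dominated_convergence[where w = ?w])
       (use wint lim bound in auto)
  moreover have "expectation (?f n) = (2 * exp ((1 / real (Suc n))\<^sup>2 * s / 2) - 2) * (real (Suc n))\<^sup>2" for n
    using int[of "1 / real (Suc n)"] int[of "- (1 / real (Suc n))"]
      E[of "1 / real (Suc n)"] E[of "- (1 / real (Suc n))"]
    by (simp add: prob_space del: of_nat_Suc)
  moreover have "(\<lambda>n. (2 * exp ((1 / real (Suc n))\<^sup>2 * s / 2) - 2) * (real (Suc n))\<^sup>2) \<longlonglongrightarrow> s"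
    by real_asymp
  ultimately show "expectation (\<lambda>\<omega>. (Y \<omega>)\<^sup>2) = s"
    by (simp only: LIMSEQ_unique)
qed

text \<open>Translating by A^-1 u completes the square in the exponent and splits off the claimed
  factor. What remains is the total mass of the given law, so \<open>c\<close> need not be
  known.\<close>

lemma distributed_gaussian_mgf:
  fixes X :: "'a \<Rightarrow> real^'n"
  assumes X: "distributed M lborel X (\<lambda>v. ennreal (c * exp (- (v \<bullet> (A *v v)) / 2)))"
    and A: "posdef A"
  shows "(\<integral>\<^sup>+\<omega>. ennreal (exp (u \<bullet> X \<omega>)) \<partial>M) = ennreal (exp (u \<bullet> (matrix_inv A *v u) / 2))"
proof -
  let ?b = "matrix_inv A *v u"
  let ?f = "\<lambda>v. ennreal (c * exp (- (v \<bullet> (A *v v)) / 2))"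
  have Asym: "transpose A = A" using A by (simp add: posdef_def)
  have "(\<integral>\<^sup>+\<omega>. ennreal (exp (u \<bullet> X \<omega>)) \<partial>M) = (\<integral>\<^sup>+v. ?f v * ennreal (exp (u \<bullet> v)) \<partial>lborel)"
    by (rule distributed_nn_integral[OF X, symmetric]) simp
  also have "\<dots> = (\<integral>\<^sup>+v. ?f (?b + v) * ennreal (exp (u \<bullet> (?b + v))) \<partial>lborel)"
    by (rule nn_integral_lborel_translate[symmetric]) simp
  also have "\<dots> = (\<integral>\<^sup>+v. ennreal (exp (u \<bullet> ?b / 2)) * ?f v \<partial>lborel)"
  proof (rule nn_integral_cong)
    fix v
    have "v \<bullet> u = u \<bullet> v" "?b \<bullet> u = u \<bullet> ?b" by (simp_all add: inner_commute)
    moreover have "?b \<bullet> (A *v v) = u \<bullet> v"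
      using inner_symmetric_matrix[OF Asym, of ?b v] by (simp add: matrix_inv_vec[OF A])
    ultimately have "- ((?b + v) \<bullet> (A *v (?b + v))) / 2 + u \<bullet> (?b + v) = u \<bullet> ?b / 2 + - (v \<bullet> (A *v v)) / 2"
      by (simp add: matrix_vector_right_distrib inner_add_left inner_add_right matrix_inv_vec[OF A] field_simps)
    then have "exp (- ((?b + v) \<bullet> (A *v (?b + v))) / 2) * exp (u \<bullet> (?b + v)) = exp (u \<bullet> ?b / 2) * exp (- (v \<bullet> (A *v v)) / 2)"
      by (simp only: flip: exp_add)
    then have "c * exp (- ((?b + v) \<bullet> (A *v (?b + v))) / 2) * exp (u \<bullet> (?b + v)) = exp (u \<bullet> ?b / 2) * (c * exp (- (v \<bullet> (A *v v)) / 2))"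
      by (simp only: mult.assoc mult.left_commute)
    then show "?f (?b + v) * ennreal (exp (u \<bullet> (?b + v))) = ennreal (exp (u \<bullet> ?b / 2)) * ?f v"
      by (simp only: ennreal_mult''[symmetric] ennreal_mult'[symmetric] exp_ge_zero)
  qed
  also have "\<dots> = ennreal (exp (u \<bullet> ?b / 2)) * (\<integral>\<^sup>+v. ?f v * 1 \<partial>lborel)"
    by (subst nn_integral_cmult) auto
  \<comment> \<open>The factor 1 puts the integral in the form of an expectation of the constant 1
    under the law of \<open>X\<close>.\<close>
  also have "(\<integral>\<^sup>+v. ?f v * 1 \<partial>lborel) = 1"
    by (subst distributed_nn_integral[OF X]) (simp_all add: emeasure_space_1)
  finally show ?thesis by simp
qed

text \<open>Each linear functional of \<open>X\<close> has a Gaussian moment generating function;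
  mixed second moments follow by polarization from the directions \<open>u + v\<close> and
  \<open>u - v\<close>.\<close>

lemma distributed_gaussian_moments:
  fixes X :: "'a \<Rightarrow> real^'n"
  assumes X: "distributed M lborel X (\<lambda>v. ennreal (c * exp (- (v \<bullet> (A *v v)) / 2)))"
    and A: "posdef A"
  shows "integrable M (\<lambda>\<omega>. u \<bullet> X \<omega>)" "expectation (\<lambda>\<omega>. u \<bullet> X \<omega>) = 0"
    "integrable M (\<lambda>\<omega>. (u \<bullet> X \<omega>) * (v \<bullet> X \<omega>))"
    "expectation (\<lambda>\<omega>. (u \<bullet> X \<omega>) * (v \<bullet> X \<omega>)) = u \<bullet> (matrix_inv A *v v)"
proof -
  have Xm[measurable]: "X \<in> borel_measurable M"
    using X by (simp add: distributed_def)
  have mgf: "(\<integral>\<^sup>+\<omega>. ennreal (exp (t * (u \<bullet> X \<omega>))) \<partial>M) = ennreal (exp (t\<^sup>2 * (u \<bullet> (matrix_inv A *v u)) / 2))" for t u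
    using distributed_gaussian_mgf[OF X A, of "t *\<^sub>R u"]
    by (simp add: matrix_vector_mult_scaleR power2_eq_square mult.assoc)
  have m: "(\<lambda>\<omega>. u \<bullet> X \<omega>) \<in> borel_measurable M" for u by simp
  note mom = moments_of_gaussian_mgf[OF m mgf]
  show "integrable M (\<lambda>\<omega>. u \<bullet> X \<omega>)" "expectation (\<lambda>\<omega>. u \<bullet> X \<omega>) = 0"
    by (rule mom(1), rule mom(2))
  have pol: "(u \<bullet> x) * (v \<bullet> x) = (((u + v) \<bullet> x)\<^sup>2 - ((u - v) \<bullet> x)\<^sup>2) / 4" for x
    by (simp add: inner_add_left inner_diff_left power2_eq_square field_simps)
  show "integrable M (\<lambda>\<omega>. (u \<bullet> X \<omega>) * (v \<bullet> X \<omega>))"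
    unfolding pol by (intro integrable_divide Bochner_Integration.integrable_diff mom(3))
  have sym: "v \<bullet> (matrix_inv A *v u) = u \<bullet> (matrix_inv A *v v)"
    using inner_symmetric_matrix[OF posdef_matrix_inv(3)[OF A], of v u] by (simp add: inner_commute)
  have diff: "expectation (\<lambda>\<omega>. ((a \<bullet> X \<omega>)\<^sup>2 - (b \<bullet> X \<omega>)\<^sup>2) / 4)
      = (a \<bullet> (matrix_inv A *v a) - b \<bullet> (matrix_inv A *v b)) / 4" for a b
    by (simp add: mom(3,4))
  show "expectation (\<lambda>\<omega>. (u \<bullet> X \<omega>) * (v \<bullet> X \<omega>)) = u \<bullet> (matrix_inv A *v v)"
    unfolding pol diff
    by (simp add: sym matrix_vector_right_distrib matrix_vector_mult_diff_distrib inner_add_left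
        inner_diff_left inner_add_right inner_diff_right)
qed

section \<open>Independence\<close>

lemma sets_vimage_algebra_rv:
  assumes "X \<in> measurable M N"
  shows "sets (vimage_algebra (space M) X N) = {X -` A \<inter> space M | A. A \<in> sets N}"
  using assms by (intro sets_vimage_algebra2) (auto simp: measurable_space)

text \<open>After composing with \<open>f\<close> and \<open>g\<close> both variables are real, so
  the product rule for \<open>indep_var\<close> applies. Their generated \<sigma>-algebras are
  contained in those of \<open>X\<close> and \<open>Y\<close>.\<close>

lemma indep_rv_integral_mult:
  fixes f g :: "_ \<Rightarrow> real"
  assumes ind: "indep_rv M N1 X N2 Y"
    and f: "f \<in> borel_measurable N1" and g: "g \<in> borel_measurable N2"
    and int: "integrable M (\<lambda>\<omega>. f (X \<omega>))" "integrable M (\<lambda>\<omega>. g (Y \<omega>))"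
  shows "integrable M (\<lambda>\<omega>. f (X \<omega>) * g (Y \<omega>))"
    "expectation (\<lambda>\<omega>. f (X \<omega>) * g (Y \<omega>)) = expectation (\<lambda>\<omega>. f (X \<omega>)) * expectation (\<lambda>\<omega>. g (Y \<omega>))"
proof -
  have X: "X \<in> measurable M N1" and Y: "Y \<in> measurable M N2"
    and iset: "indep_set (sets (vimage_algebra (space M) X N1)) (sets (vimage_algebra (space M) Y N2))"
    using ind unfolding indep_rv_def by auto
  have sub: "sigma_sets (space M) {(\<lambda>\<omega>. h (Z \<omega>)) -` A \<inter> space M |A. A \<in> sets borel} \<subseteq> sets (vimage_algebra (space M) Z N)"
    if Z: "Z \<in> measurable M N" and h: "h \<in> borel_measurable N" for Z N and h :: "_ \<Rightarrow> real"
  proof (rule sets.sigma_sets_subset')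
    show "{(\<lambda>\<omega>. h (Z \<omega>)) -` A \<inter> space M |A. A \<in> sets borel} \<subseteq> sets (vimage_algebra (space M) Z N)"
    proof safe
      fix A :: "real set" assume "A \<in> sets borel"
      then have "h -` A \<inter> space N \<in> sets N" using h by (rule measurable_sets[rotated])
      then have "Z -` (h -` A \<inter> space N) \<inter> space M \<in> sets (vimage_algebra (space M) Z N)"
        by (rule in_vimage_algebra)
      moreover have "Z -` (h -` A \<inter> space N) \<inter> space M = (\<lambda>\<omega>. h (Z \<omega>)) -` A \<inter> space M"
        using measurable_space[OF Z] by auto
      ultimately show "(\<lambda>\<omega>. h (Z \<omega>)) -` A \<inter> space M \<in> sets (vimage_algebra (space M) Z N)" by simp
    qed
    show "space M \<in> sets (vimage_algebra (space M) Z N)"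
      by (metis sets.top space_vimage_algebra)
  qed
  have "indep_var borel (\<lambda>\<omega>. f (X \<omega>)) borel (\<lambda>\<omega>. g (Y \<omega>))"
    unfolding indep_var_eq
  proof (intro conjI)
    show "indep_set (sigma_sets (space M) {(\<lambda>\<omega>. f (X \<omega>)) -` A \<inter> space M |A. A \<in> sets borel})
        (sigma_sets (space M) {(\<lambda>\<omega>. g (Y \<omega>)) -` A \<inter> space M |A. A \<in> sets borel})"
      using iset unfolding indep_set_def
      by (rule indep_sets_mono_sets) (use sub[OF X f] sub[OF Y g] in \<open>auto split: bool.split\<close>)
  qed (use X Y f g in auto)
  then show "integrable M (\<lambda>\<omega>. f (X \<omega>) * g (Y \<omega>))"
    "expectation (\<lambda>\<omega>. f (X \<omega>) * g (Y \<omega>)) = expectation (\<lambda>\<omega>. f (X \<omega>)) * expectation (\<lambda>\<omega>. g (Y \<omega>))"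
    using indep_var_integrable[OF _ int] indep_var_lebesgue_integral[OF _ int] by auto
qed

lemma indep_rv_distr_pair:
  assumes ind: "indep_rv M N1 X N2 Y"
  shows "distr M N1 X \<Otimes>\<^sub>M distr M N2 Y = distr M (N1 \<Otimes>\<^sub>M N2) (\<lambda>\<omega>. (X \<omega>, Y \<omega>))"
proof (rule pair_measure_eqI)
  have X[measurable]: "X \<in> measurable M N1" and Y[measurable]: "Y \<in> measurable M N2"
    and iset: "indep_set (sets (vimage_algebra (space M) X N1)) (sets (vimage_algebra (space M) Y N2))"
    using ind unfolding indep_rv_def by auto
  interpret X: prob_space "distr M N1 X" by (rule prob_space_distr) simp
  interpret Y: prob_space "distr M N2 Y" by (rule prob_space_distr) simp
  show "sigma_finite_measure (distr M N1 X)" "sigma_finite_measure (distr M N2 Y)"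
    by unfold_locales
  show "sets (distr M N1 X \<Otimes>\<^sub>M distr M N2 Y) = sets (distr M (N1 \<Otimes>\<^sub>M N2) (\<lambda>\<omega>. (X \<omega>, Y \<omega>)))"
    by simp
  fix A B assume "A \<in> sets (distr M N1 X)" "B \<in> sets (distr M N2 Y)"
  then have [measurable]: "A \<in> sets N1" "B \<in> sets N2" by auto
  have "prob ((X -` A \<inter> space M) \<inter> (Y -` B \<inter> space M)) = prob (X -` A \<inter> space M) * prob (Y -` B \<inter> space M)"
    by (rule indep_setD[OF iset]) (auto intro!: in_vimage_algebra)
  moreover have "(\<lambda>\<omega>. (X \<omega>, Y \<omega>)) -` (A \<times> B) \<inter> space M = (X -` A \<inter> space M) \<inter> (Y -` B \<inter> space M)"
    by auto
  ultimately show "emeasure (distr M N1 X) A * emeasure (distr M N2 Y) B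
      = emeasure (distr M (N1 \<Otimes>\<^sub>M N2) (\<lambda>\<omega>. (X \<omega>, Y \<omega>))) (A \<times> B)"
    by (simp add: emeasure_distr emeasure_eq_measure ennreal_mult')
qed

text \<open>The factors \<open>\<mu>\<close> and \<open>\<nu>\<close> need not be normalized: their
  total masses have product 1, and inserting this product turns the factorization into a product of
  marginals.\<close>

lemma indep_rv_of_factorization:
  assumes X[measurable]: "X \<in> measurable M N1" and Y[measurable]: "Y \<in> measurable M N2"
    and fac: "\<And>A B. A \<in> sets N1 \<Longrightarrow> B \<in> sets N2 \<Longrightarrow>
      emeasure M ((X -` A \<inter> space M) \<inter> (Y -` B \<inter> space M)) = \<mu> A * \<nu> B"
  shows "indep_rv M N1 X N2 Y" "\<And>A. A \<in> sets N1 \<Longrightarrow> emeasure (distr M N1 X) A = \<mu> A * \<nu> (space N2)"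
    "\<mu> (space N1) * \<nu> (space N2) = 1"
proof -
  have sX: "X -` space N1 \<inter> space M = space M" and sY: "Y -` space N2 \<inter> space M = space M"
    using measurable_space[OF X] measurable_space[OF Y] by auto
  have 1: "emeasure M (X -` A \<inter> space M) = \<mu> A * \<nu> (space N2)" if "A \<in> sets N1" for A
    using fac[OF that sets.top] that by (simp add: sY Int_absorb2)
  have 2: "emeasure M (Y -` B \<inter> space M) = \<mu> (space N1) * \<nu> B" if "B \<in> sets N2" for B
    using fac[OF sets.top that] that by (simp add: sX Int_absorb1)
  show 3: "\<mu> (space N1) * \<nu> (space N2) = 1"
    using 1[OF sets.top] by (simp add: sX emeasure_space_1)
  show "emeasure (distr M N1 X) A = \<mu> A * \<nu> (space N2)" if "A \<in> sets N1" for A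
    using that by (simp add: emeasure_distr 1)
  show "indep_rv M N1 X N2 Y"
    unfolding indep_rv_def
  proof (intro conjI X Y indep_setI)
    show "sets (vimage_algebra (space M) X N1) \<subseteq> events" "sets (vimage_algebra (space M) Y N2) \<subseteq> events"
      by (auto simp: sets_vimage_algebra_rv[OF X] sets_vimage_algebra_rv[OF Y])
    fix a b assume "a \<in> sets (vimage_algebra (space M) X N1)" "b \<in> sets (vimage_algebra (space M) Y N2)"
    then obtain A B where AB: "A \<in> sets N1" "B \<in> sets N2" "a = X -` A \<inter> space M" "b = Y -` B \<inter> space M"
      by (auto simp: sets_vimage_algebra_rv[OF X] sets_vimage_algebra_rv[OF Y])
    have "emeasure M (a \<inter> b) = \<mu> A * \<nu> B * (\<mu> (space N1) * \<nu> (space N2))"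
      unfolding 3 AB(3,4) using fac[OF AB(1,2)] by simp
    also have "\<dots> = emeasure M a * emeasure M b"
      unfolding AB(3,4) 1[OF AB(1)] 2[OF AB(2)] by (simp add: mult_ac)
    finally show "prob (a \<inter> b) = prob a * prob b"
      by (simp add: emeasure_eq_measure flip: ennreal_mult')
  qed
qed

end

section \<open>The posterior residual is independent of the observations\<close>

text \<open>The normal equation for \<open>m\<close> reads Q m = K (\<beta> - m), so the terms
  linear in \<open>u\<close> cancel.\<close>

lemma complete_square_posterior:
  fixes Q K :: "real^'n^'n"
  assumes "transpose Q = Q" "transpose K = K" "posdef (Q + K)"
    and m: "m = matrix_inv (Q + K) *v (K *v \<beta>)"
  shows "(m + u) \<bullet> (Q *v (m + u)) + (\<beta> - (m + u)) \<bullet> (K *v (\<beta> - (m + u)))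
    = u \<bullet> ((Q + K) *v u) + (m \<bullet> (Q *v m) + (\<beta> - m) \<bullet> (K *v (\<beta> - m)))"
proof -
  have "(Q + K) *v m = K *v \<beta>"
    unfolding m by (rule matrix_inv_vec[OF assms(3)])
  then have "Q *v m = K *v (\<beta> - m)"
    by (simp add: matrix_vector_mult_add_rdistrib matrix_vector_mult_diff_distrib algebra_simps)
  moreover have "m \<bullet> (Q *v u) = u \<bullet> (Q *v m)" "(\<beta> - m) \<bullet> (K *v u) = u \<bullet> (K *v (\<beta> - m))"
    using inner_symmetric_matrix[OF assms(1), of m u] inner_symmetric_matrix[OF assms(2), of "\<beta> - m" u]
    by (simp_all add: inner_commute)
  moreover have "(\<beta> - (m + u)) \<bullet> (K *v (\<beta> - (m + u)))
    = (\<beta> - m) \<bullet> (K *v (\<beta> - m)) - (\<beta> - m) \<bullet> (K *v u) - u \<bullet> (K *v (\<beta> - m)) + u \<bullet> (K *v u)"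
  proof -
    have e: "\<beta> - (m + u) = (\<beta> - m) - u" by simp
    show ?thesis unfolding e
      by (simp only: matrix_vector_mult_diff_distrib[of K "\<beta> - m" u] inner_diff_left[of "\<beta> - m" u] inner_diff_right)
  qed
  ultimately show ?thesis
    by (simp add: matrix_vector_right_distrib matrix_vector_mult_add_rdistrib inner_add_left inner_add_right)
qed

context prob_space
begin

text \<open>Independence is assumed over \<open>borel\<close> and densities over
  \<open>lborel\<close>; this passes between measures with the same measurable sets.\<close>

lemma indep_rv_cong_sets:
  assumes "indep_rv M N1 X N2 Y" "sets N1 = sets N1'" "sets N2 = sets N2'"
  shows "indep_rv M N1' X N2' Y"
  using assms(1) unfolding indep_rv_def
  by (simp add: measurable_cong_sets[OF refl assms(2)] measurable_cong_sets[OF refl assms(3)]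
      sets_vimage_algebra_cong[OF assms(2)] sets_vimage_algebra_cong[OF assms(3)])

lemma borel_measurable_post_mean:
  "post_mean Q S R x \<in> borel_measurable (PiM S (\<lambda>_. borel))"
  unfolding post_mean_def
  by (intro borel_measurable_matrix_vector borel_measurable_sum borel_measurable_scaleR borel_measurable_times
      borel_measurable_diff measurable_component_singleton) auto

lemma borel_measurable_obs_residual:
  "obs_residual S x \<in> borel_measurable (PiM S (\<lambda>_. borel))"
  unfolding obs_residual_def
proof (rule borel_measurable_vec_lambda)
  show "(\<lambda>z. if j \<in> S then z j - x $ j else 0) \<in> borel_measurable (PiM S (\<lambda>_. borel))" for j
    by (cases "j \<in> S") auto
qed

text \<open>The probability of a joint event for \<open>r\<close> and \<open>y\<close> is an
  integral over prior and noise. Replacing the noise by the observation z, and then the residual by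
  u = d - m z, uses translations only, so no Jacobian appears and the integrand becomes a function
  of u times a function of z.\<close>

lemma posterior_residual:
  fixes \<delta> r :: "'a \<Rightarrow> real^'n" and \<eta> y :: "'a \<Rightarrow> 'n \<Rightarrow> real"
  assumes Q: "posdef Q" and R: "posdef_on S R" and a: "0 < a" and b: "0 < b"
    and D: "distributed M lborel \<delta> (\<lambda>v. ennreal (a * exp (- (v \<bullet> (Q *v v)) / 2)))"
    and E: "distributed M (PiM S (\<lambda>_. lborel)) \<eta>
      (\<lambda>e. ennreal (b * exp (- (\<Sum>j\<in>S. \<Sum>l\<in>S. e j * inverse_on S R j l * e l) / 2)))"
    and ind: "indep_rv M borel \<delta> (PiM S (\<lambda>_. borel)) \<eta>"
    and y: "\<And>\<omega>. y \<omega> = observe S (x + \<delta> \<omega>) (\<eta> \<omega>)"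
    and r: "\<And>\<omega>. r \<omega> = \<delta> \<omega> - post_mean Q S R x (y \<omega>)"
  shows "indep_rv M borel r (PiM S (\<lambda>_. borel)) y" (is ?indep)
    "\<exists>c. distributed M lborel r (\<lambda>v. ennreal (c * exp (- (v \<bullet> (post_precision Q S R *v v)) / 2)))" (is ?distr)
proof -
  let ?L = "PiM S (\<lambda>_. lborel :: real measure)" and ?B = "PiM S (\<lambda>_. borel :: real measure)"
  interpret PS: product_sigma_finite "\<lambda>_ :: 'n. lborel :: real measure"
    by standard
  interpret L: sigma_finite_measure ?L by (rule PS.sigma_finite) simp
  interpret LL: pair_sigma_finite "lborel :: (real^'n) measure" ?L ..
  have sL: "sets ?L = sets ?B"
    by (rule sets_PiM_cong) auto
  define K where "K = embed_block S (inverse_on S R)"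
  define A where "A = post_precision Q S R"
  define m where "m = post_mean Q S R x"
  define \<beta> where "\<beta> = obs_residual S x"
  have A: "A = Q + K" unfolding A_def K_def by (rule post_precision_embed_block)
  have Apos: "posdef A" unfolding A_def by (rule posdef_post_precision[OF Q R])
  have Qsym: "transpose Q = Q" using Q by (simp add: posdef_def)
  have Ksym: "transpose K = K"
    using inverse_on_symmetric[OF R] by (simp add: K_def transpose_def vec_eq_iff embed_block_def)
  have m_eq: "m z = matrix_inv (Q + K) *v (K *v \<beta> z)" for z
    unfolding m_def \<beta>_def K_def post_mean_embed_block post_cov_def post_precision_embed_block ..
  \<comment> \<open>Here \<open>f\<close> is the prior density, \<open>g0\<close> the noise density
    and \<open>g\<close> the noise density rewritten in terms of the observation; \<open>p\<close>
    and \<open>h\<close> are the factors in residual and observation, with both constants put into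
    \<open>h\<close>.\<close>
  define f where "f d = a * exp (- (d \<bullet> (Q *v d)) / 2)" for d
  define g where "g d z = b * exp (- ((\<beta> z - d) \<bullet> (K *v (\<beta> z - d))) / 2)" for d z
  define g0 where "g0 e = b * exp (- (\<Sum>j\<in>S. \<Sum>l\<in>S. e j * inverse_on S R j l * e l) / 2)" for e
  define h where "h z = a * b * exp (- (m z \<bullet> (Q *v m z) + (\<beta> z - m z) \<bullet> (K *v (\<beta> z - m z))) / 2)" for z
  define p where "p u = exp (- (u \<bullet> (A *v u)) / 2)" for u
  define T where "T d e = (\<lambda>j\<in>S. (x $ j + d $ j) + e j)" for d :: "real^'n" and e :: "'n \<Rightarrow> real"
  have fg: "f (m z + u) * g (m z + u) z = p u * h z" for z u
  proof -
    have "f (m z + u) * g (m z + u) z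
      = a * b * exp (- ((m z + u) \<bullet> (Q *v (m z + u)) + (\<beta> z - (m z + u)) \<bullet> (K *v (\<beta> z - (m z + u)))) / 2)"
      by (simp add: f_def g_def add_divide_distrib flip: exp_add)
    also have "(m z + u) \<bullet> (Q *v (m z + u)) + (\<beta> z - (m z + u)) \<bullet> (K *v (\<beta> z - (m z + u)))
      = u \<bullet> (A *v u) + (m z \<bullet> (Q *v m z) + (\<beta> z - m z) \<bullet> (K *v (\<beta> z - m z)))"
      unfolding A by (rule complete_square_posterior[OF Qsym Ksym Apos[unfolded A] m_eq])
    also have "a * b * exp (- (u \<bullet> (A *v u) + (m z \<bullet> (Q *v m z) + (\<beta> z - m z) \<bullet> (K *v (\<beta> z - m z)))) / 2) = p u * h z"
      unfolding p_def h_def by (simp add: add_divide_distrib exp_diff exp_minus divide_simps flip: exp_add)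
    finally show ?thesis .
  qed
  have nn: "0 \<le> f d" "0 \<le> g d z" "0 \<le> p d" "0 \<le> h z" for d z
    using a b by (simp_all add: f_def g_def p_def h_def)
  have g0: "g0 e = g d (T d e)" for d e
  proof -
    have "(\<beta> (T d e) - d) $ j = e j" if "j \<in> S" for j
      using that by (simp add: \<beta>_def obs_residual_def T_def)
    then show ?thesis
      unfolding g0_def g_def K_def inner_embed_block by (simp cong: sum.cong)
  qed
  have m_meas[measurable]: "m \<in> borel_measurable ?L"
    using borel_measurable_post_mean[of Q S R x] unfolding m_def by (simp add: measurable_cong_sets[OF sL refl])
  have \<beta>_meas[measurable]: "\<beta> \<in> borel_measurable ?L"
    using borel_measurable_obs_residual[of S x] unfolding \<beta>_def by (simp add: measurable_cong_sets[OF sL refl])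
  have [measurable]: "f \<in> borel_measurable borel" "p \<in> borel_measurable borel"
    unfolding f_def[abs_def] p_def[abs_def] by measurable
  have [measurable]: "h \<in> borel_measurable ?L"
    unfolding h_def[abs_def] by measurable
  have [measurable]: "(\<lambda>(d, z). g d z) \<in> borel_measurable (borel \<Otimes>\<^sub>M ?L)"
    unfolding g_def by measurable
  have T_meas[measurable]: "(\<lambda>(d, e). T d e) \<in> measurable (borel \<Otimes>\<^sub>M ?L) ?L"
    unfolding T_def by measurable
  have ind': "indep_rv M lborel \<delta> ?L \<eta>"
    using ind by (rule indep_rv_cong_sets) (simp_all add: sL)
  have joint: "distributed M (lborel \<Otimes>\<^sub>M ?L) (\<lambda>\<omega>. (\<delta> \<omega>, \<eta> \<omega>)) (\<lambda>(d, e). ennreal (f d) * ennreal (g0 e))"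
    unfolding f_def g0_def
    by (rule distributed_joint_indep'[OF _ _ D E indep_rv_distr_pair[OF ind']]) unfold_locales
  have \<delta>_meas[measurable]: "\<delta> \<in> borel_measurable M" and \<eta>_meas[measurable]: "\<eta> \<in> measurable M ?L"
    using D E by (simp_all add: distributed_def)
  have y_T: "y \<omega> = T (\<delta> \<omega>) (\<eta> \<omega>)" for \<omega>
    unfolding y observe_def T_def by (simp add: inner_obs_row)
  have y_meas[measurable]: "y \<in> measurable M ?L"
    unfolding y_T[abs_def] by measurable
  then have yB: "y \<in> measurable M ?B"
    by (simp add: measurable_cong_sets[OF refl sL])
  have r_meas[measurable]: "r \<in> borel_measurable M"
    unfolding r[abs_def] m_def[symmetric] by measurable
  define \<mu> where "\<mu> X = (\<integral>\<^sup>+u. ennreal (p u) * indicator X u \<partial>lborel)" for X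
  define \<nu> where "\<nu> Z = (\<integral>\<^sup>+z. ennreal (h z) * indicator Z z \<partial>?L)" for Z
  have fac: "emeasure M ((r -` X \<inter> space M) \<inter> (y -` Z \<inter> space M)) = \<mu> X * \<nu> Z"
    if X[measurable]: "X \<in> sets borel" and ZB: "Z \<in> sets ?B" for X Z
  proof -
    have Z[measurable]: "Z \<in> sets ?L" using ZB sL by simp
    \<comment> \<open>The joint event for \<open>r\<close> and \<open>y\<close>, pulled back to the
      space of pairs of prior residual and noise, where the joint density is known.\<close>
    define W where "W = {q \<in> space (lborel \<Otimes>\<^sub>M ?L). fst q - m (T (fst q) (snd q)) \<in> X \<and> T (fst q) (snd q) \<in> Z}"
    have W[measurable]: "W \<in> sets (lborel \<Otimes>\<^sub>M ?L)"
      unfolding W_def by measurable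
    have "(r -` X \<inter> space M) \<inter> (y -` Z \<inter> space M) = (\<lambda>\<omega>. (\<delta> \<omega>, \<eta> \<omega>)) -` W \<inter> space M"
      using measurable_space[OF \<eta>_meas]
      by (auto simp: W_def r y_T m_def space_pair_measure)
    then have "emeasure M ((r -` X \<inter> space M) \<inter> (y -` Z \<inter> space M))
      = (\<integral>\<^sup>+q. (case q of (d, e) \<Rightarrow> ennreal (f d) * ennreal (g0 e)) * indicator W q \<partial>(lborel \<Otimes>\<^sub>M ?L))"
      by (simp only: distributed_emeasure[OF joint W])
    also have "\<dots> = (\<integral>\<^sup>+d. \<integral>\<^sup>+e. ennreal (f d) * ennreal (g0 e) * indicator W (d, e) \<partial>?L \<partial>lborel)"
      using joint by (subst L.nn_integral_fst[symmetric]) (auto simp: distributed_def)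
    also have "\<dots> = (\<integral>\<^sup>+d. \<integral>\<^sup>+e. ennreal (f d) * ennreal (g d (T d e)) * (indicator X (d - m (T d e)) * indicator Z (T d e)) \<partial>?L \<partial>lborel)"
      by (intro nn_integral_cong) (auto simp: W_def space_pair_measure g0[symmetric] split: split_indicator)
    \<comment> \<open>For fixed d the map \<open>T d\<close> is a translation of the noise
      space.\<close>
    also have "\<dots> = (\<integral>\<^sup>+d. \<integral>\<^sup>+z. ennreal (f d) * ennreal (g d z) * (indicator X (d - m z) * indicator Z z) \<partial>?L \<partial>lborel)"
      unfolding T_def by (intro nn_integral_cong nn_integral_PiM_lborel_translate) measurable
    also have "\<dots> = (\<integral>\<^sup>+z. \<integral>\<^sup>+d. ennreal (f d) * ennreal (g d z) * (indicator X (d - m z) * indicator Z z) \<partial>lborel \<partial>?L)"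
      by (rule LL.Fubini'[symmetric]) measurable
    \<comment> \<open>The exchange of integrals has made z fixed, so d can be translated by the
      posterior mean \<open>m z\<close>.\<close>
    also have "\<dots> = (\<integral>\<^sup>+z. \<integral>\<^sup>+u. ennreal (f (m z + u)) * ennreal (g (m z + u) z) * (indicator X (m z + u - m z) * indicator Z z) \<partial>lborel \<partial>?L)"
      by (intro nn_integral_cong nn_integral_lborel_translate[symmetric]) measurable
    also have "\<dots> = (\<integral>\<^sup>+z. \<integral>\<^sup>+u. ennreal (p u) * indicator X u * (ennreal (h z) * indicator Z z) \<partial>lborel \<partial>?L)"
    proof (intro nn_integral_cong)
      fix z u
      have "ennreal (f (m z + u)) * ennreal (g (m z + u) z) = ennreal (p u) * ennreal (h z)"
        by (simp only: nn fg flip: ennreal_mult)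
      then show "ennreal (f (m z + u)) * ennreal (g (m z + u) z) * (indicator X (m z + u - m z) * indicator Z z)
          = ennreal (p u) * indicator X u * (ennreal (h z) * indicator Z z)"
        by (simp add: mult_ac)
    qed
    also have "\<dots> = \<mu> X * \<nu> Z"
      unfolding \<mu>_def \<nu>_def by (simp add: nn_integral_multc nn_integral_cmult)
    finally show ?thesis .
  qed
  show ?indep
    by (rule indep_rv_of_factorization(1)[OF r_meas yB]) (rule fac)
  have distr_r: "emeasure (distr M borel r) X = \<mu> X * \<nu> (space ?B)" if "X \<in> sets borel" for X
    by (rule indep_rv_of_factorization(2)[OF r_meas yB _ that]) (rule fac)
  have total: "\<mu> (space borel) * \<nu> (space ?B) = 1"
    by (rule indep_rv_of_factorization(3)[OF r_meas yB]) (rule fac)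
  \<comment> \<open>An infinite factor makes a product in \<open>ennreal\<close> either 0 or
    infinite, never 1. Hence this mass is a real number, which serves as the constant of the density
    of \<open>r\<close>.\<close>
  have "\<nu> (space ?B) \<noteq> \<top>"
  proof
    assume "\<nu> (space ?B) = \<top>"
    with total show False by (simp add: ennreal_mult_top split: if_splits)
  qed
  then obtain c where c: "0 \<le> c" "\<nu> (space ?B) = ennreal c"
    by (cases "\<nu> (space ?B)" rule: ennreal_cases) blast+
  have "distr M lborel r = density lborel (\<lambda>v. ennreal (c * p v))"
  proof (rule measure_eqI)
    fix X assume "X \<in> sets (distr M lborel r)"
    then have X[measurable]: "X \<in> sets borel" by simp
    have "emeasure (distr M lborel r) X = emeasure (distr M borel r) X"
      by (simp add: emeasure_distr)
    also have "\<dots> = \<mu> X * ennreal c"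
      unfolding distr_r[OF X] c(2) ..
    also have "\<dots> = (\<integral>\<^sup>+v. ennreal c * (ennreal (p v) * indicator X v) \<partial>lborel)"
      unfolding \<mu>_def by (subst mult.commute) (rule nn_integral_cmult[symmetric], measurable)
    also have "\<dots> = (\<integral>\<^sup>+v. ennreal (c * p v) * indicator X v \<partial>lborel)"
      by (simp only: ennreal_mult'[OF c(1)] mult.assoc)
    also have "\<dots> = emeasure (density lborel (\<lambda>v. ennreal (c * p v))) X"
      by (rule emeasure_density[symmetric]) simp_all
    finally show "emeasure (distr M lborel r) X = emeasure (density lborel (\<lambda>v. ennreal (c * p v))) X" .
  qed simp
  then have "distributed M lborel r (\<lambda>v. ennreal (c * p v))"
    unfolding distributed_def by simp
  then show ?distr
    unfolding p_def A_def by blast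
qed

end

section \<open>One-step improvement\<close>

lemma weighted_norm_sq_diff:
  assumes "transpose W = W"
  shows "weighted_norm_sq W q - weighted_norm_sq W (q - c *\<^sub>R k)
    = 2 * c * ((W *v k) \<bullet> q) - c\<^sup>2 * ((W *v k) \<bullet> k)"
proof -
  have "q \<bullet> (W *v k) = (W *v k) \<bullet> q" "k \<bullet> (W *v q) = (W *v k) \<bullet> q" "k \<bullet> (W *v k) = (W *v k) \<bullet> k"
    using inner_symmetric_matrix[OF assms, of k q] by (simp_all add: inner_commute)
  then show ?thesis
    unfolding weighted_norm_sq_def
    by (simp add: matrix_vector_mult_diff_distrib matrix_vector_mult_scaleR inner_diff_left inner_diff_right
        power2_eq_square algebra_simps)
qed

lemma transpose_diag_matrix: "transpose (diag_matrix w) = diag_matrix w"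
  by (auto simp: transpose_def diag_matrix_def vec_eq_iff)

text \<open>An identity for each outcome: the first error is r + (1 - \<rho>) m, and the second
  differs from it by \<rho> times the innovation times the gain.\<close>

lemma refined_estimate_improvement:
  fixes Q :: "real^'n^'n"
  assumes Q: "posdef Q" and R: "posdef_on S R" and i: "i \<notin> S" and s: "0 < s"
    and W: "transpose W = W"
    and agree: "\<And>j. j \<in> S \<Longrightarrow> y1 j = y j" and y1: "y1 i = x $ i + d $ i + n"
    and r: "r = d - post_mean Q S R x y"
    and k: "k = kalman_gain (post_cov Q S R) s i"
  shows "weighted_norm_sq W (x + d - refined_estimate Q S R x \<rho> y) -
      weighted_norm_sq W (x + d - refined_estimate Q (insert i S) (extend_cov S R i s) x \<rho> y1)
    = 2 * \<rho> * ((axis i 1 \<bullet> r + n) * ((W *v k) \<bullet> r + (1 - \<rho>) * ((W *v k) \<bullet> post_mean Q S R x y)))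
      - \<rho>\<^sup>2 * ((W *v k) \<bullet> k) * (axis i 1 \<bullet> r + n)\<^sup>2"
proof -
  let ?m = "post_mean Q S R x y"
  \<comment> \<open>The posterior mean over \<open>S\<close> reads observations at indices in
    \<open>S\<close> only, where \<open>y1\<close> and \<open>y\<close> agree.\<close>
  have "post_mean Q S R x y1 = ?m"
    unfolding post_mean_def using agree by (simp cong: sum.cong)
  then have pm: "post_mean Q (insert i S) (extend_cov S R i s) x y1 = ?m + (axis i 1 \<bullet> r + n) *\<^sub>R k"
    unfolding post_mean_extend[OF Q R i s] k by (simp add: y1 r inner_axis' algebra_simps)
  then have 1: "x + d - refined_estimate Q (insert i S) (extend_cov S R i s) x \<rho> y1
      = (r + (1 - \<rho>) *\<^sub>R ?m) - (\<rho> * (axis i 1 \<bullet> r + n)) *\<^sub>R k"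
    unfolding refined_estimate_def pm by (simp add: r algebra_simps)
  have 2: "x + d - refined_estimate Q S R x \<rho> y = r + (1 - \<rho>) *\<^sub>R ?m"
    unfolding refined_estimate_def by (simp add: r algebra_simps)
  show ?thesis
    unfolding 1 2 weighted_norm_sq_diff[OF W]
    by (simp only: inner_add_right inner_scaleR_right power_mult_distrib mult_ac)
qed

text \<open>The two expressions are the coefficients produced by the cross term and by the squared
  innovation. The second equals the utility because the innovation variance cancels the denominator
  of the gain.\<close>

lemma utility_eq_gain:
  fixes Q :: "real^'n^'n" and w :: "real^'n"
  assumes Q: "posdef Q" and R: "posdef_on S R" and i: "i \<notin> S" and s: "0 < s"
    and k: "k = kalman_gain (post_cov Q S R) s i" and a: "a = diag_matrix w *v k"
  shows "axis i 1 \<bullet> (post_cov Q S R *v a) = utility (diag_matrix w) Q S R s i"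
    "(a \<bullet> k) * (axis i 1 \<bullet> (post_cov Q S R *v axis i 1) + s) = utility (diag_matrix w) Q S R s i"
proof -
  let ?P = "post_cov Q S R"
  have U: "utility (diag_matrix w) Q S R s i = a \<bullet> (?P *v axis i 1)"
    unfolding a k by (rule utility_kalman_gain[OF Q R i s])
  have "transpose ?P = ?P"
    unfolding post_cov_def by (rule posdef_matrix_inv(3)[OF posdef_post_precision[OF Q R]])
  from inner_symmetric_matrix[OF this, of "axis i 1" a]
  show "axis i 1 \<bullet> (?P *v a) = utility (diag_matrix w) Q S R s i"
    unfolding U by (simp add: inner_commute)
  have "axis i 1 \<bullet> (?P *v axis i 1) + s = s + ?P $ i $ i"
    by (simp add: inner_axis' matrix_vector_mult_basis column_def)
  moreover have "0 < s + ?P $ i $ i"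
    using post_cov_diag_pos[OF Q R i s] s by simp
  ultimately show "(a \<bullet> k) * (axis i 1 \<bullet> (?P *v axis i 1) + s) = utility (diag_matrix w) Q S R s i"
    unfolding U by (simp add: k kalman_gain_def add.commute[of s])
qed

section \<open>From the Gaussian hypotheses to the conditional expectation\<close>

context prob_space
begin

text \<open>A nonpositive constant would make the density vanish in \<open>ennreal\<close>,
  contradicting total mass 1. This yields positive normalizing constants without evaluating a
  determinant.\<close>

lemma distributed_scale_pos:
  assumes D: "distributed M N X (\<lambda>v. ennreal (a * f v))" and "\<And>v. 0 \<le> f v"
  shows "0 < (a::real)"
proof (rule ccontr)
  assume "\<not> 0 < a"
  then have "ennreal (a * f v) = 0" for v
    using assms(2)[of v] by (intro ennreal_neg) (simp add: mult_nonpos_nonneg)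
  then have "emeasure (distr M N X) (space N) = 0"
    using D by (simp add: distributed_def emeasure_density)
  moreover have "X -` space N \<inter> space M = space M"
    using D measurable_space[of X M N] by (auto simp: distributed_def)
  ultimately show False
    using D by (simp add: emeasure_distr distributed_def emeasure_space_1)
qed

text \<open>Inverting the covariance returns \<open>Q\<close> in the exponent, and the determinant
  is hidden in the constant \<open>a\<close>.\<close>

lemma gaussian_on_UNIV_density:
  fixes \<delta> :: "'a \<Rightarrow> real^'n"
  assumes Q: "posdef Q"
    and D: "gaussian_on M UNIV (\<lambda>\<omega> j. \<delta> \<omega> $ j) (\<lambda>_. 0) (\<lambda>j l. matrix_inv Q $ j $ l)"
  shows "\<exists>a>0. distributed M lborel \<delta> (\<lambda>v. ennreal (a * exp (- (v \<bullet> (Q *v v)) / 2)))"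
proof -
  have "invertible (matrix_inv Q)"
    unfolding invertible_def using posdef_matrix_inv[OF Q] by blast
  then have inv: "inverse_on UNIV (\<lambda>j l. matrix_inv Q $ j $ l) = (\<lambda>j l. Q $ j $ l)"
    using matrix_inv_involutive[OF Q] by (simp add: inverse_on_UNIV)
  define a where "a = 1 / sqrt ((2 * pi) ^ CARD('n) * det_on UNIV (\<lambda>j l. matrix_inv Q $ j $ l))"
  have "(\<Sum>j\<in>UNIV. \<Sum>l\<in>UNIV. (v j - 0) * Q $ j $ l * (v l - 0)) = vec_lambda v \<bullet> (Q *v vec_lambda v)" for v
    by (simp add: inner_vec_def matrix_vector_mult_def sum_distrib_left mult.assoc)
  then have "mvn_density_on UNIV (\<lambda>_. 0) (\<lambda>j l. matrix_inv Q $ j $ l) v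
      = a * exp (- (vec_lambda v \<bullet> (Q *v vec_lambda v)) / 2)" for v
    unfolding mvn_density_on_def inv a_def by simp
  then have "distributed M (PiM UNIV (\<lambda>_. lborel)) (\<lambda>\<omega> j. \<delta> \<omega> $ j)
      (\<lambda>v. (\<lambda>v. ennreal (a * exp (- (v \<bullet> (Q *v v)) / 2))) (vec_lambda v))"
    using D unfolding gaussian_on_def by simp
  then have "distributed M lborel \<delta> (\<lambda>v. ennreal (a * exp (- (v \<bullet> (Q *v v)) / 2)))"
    by (rule distributed_vec) measurable
  with distributed_scale_pos[OF this] show ?thesis by auto
qed

lemma gaussian_on_centered_density:
  assumes "gaussian_on M S \<eta> (\<lambda>_. 0) R"
  shows "\<exists>b>0. distributed M (PiM S (\<lambda>_. lborel)) \<eta>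
    (\<lambda>e. ennreal (b * exp (- (\<Sum>j\<in>S. \<Sum>l\<in>S. e j * inverse_on S R j l * e l) / 2)))"
proof -
  define b where "b = 1 / sqrt ((2 * pi) ^ card S * det_on S R)"
  have "distributed M (PiM S (\<lambda>_. lborel)) \<eta>
    (\<lambda>e. ennreal (b * exp (- (\<Sum>j\<in>S. \<Sum>l\<in>S. e j * inverse_on S R j l * e l) / 2)))"
    using assms unfolding gaussian_on_def mvn_density_on_def b_def by simp
  with distributed_scale_pos[OF this] show ?thesis by auto
qed

lemma normal_centered_moments:
  assumes D: "distributed M lborel X (\<lambda>v. ennreal (normal_density 0 \<sigma> v))" and \<sigma>: "0 < \<sigma>"
  shows "integrable M X" "expectation X = 0" "integrable M (\<lambda>\<omega>. (X \<omega>)\<^sup>2)" "expectation (\<lambda>\<omega>. (X \<omega>)\<^sup>2) = \<sigma>\<^sup>2"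
proof -
  show "integrable M X"
    using distributed_integrable[OF D, of "\<lambda>x. x"] integrable_normal_moment[OF \<sigma>, of 0 1] by simp
  show m: "expectation X = 0"
    by (rule normal_distributed_expectation[OF \<sigma> D])
  show "integrable M (\<lambda>\<omega>. (X \<omega>)\<^sup>2)"
    using distributed_integrable[OF D, of "\<lambda>x. x\<^sup>2"] integrable_normal_moment[OF \<sigma>, of 0 2] by simp
  show "expectation (\<lambda>\<omega>. (X \<omega>)\<^sup>2) = \<sigma>\<^sup>2"
    using normal_distributed_variance[OF \<sigma> D] m by simp
qed

text \<open>Carrying integrability and value together allows the long expansion below to be
  assembled by linearity rules alone.\<close>

lemma indep_rv_has_integral_mult:
  fixes f g :: "_ \<Rightarrow> real"
  assumes ind: "indep_rv M N1 X N2 Y"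
    and "f \<in> borel_measurable N1" "g \<in> borel_measurable N2"
    and "has_bochner_integral M (\<lambda>\<omega>. f (X \<omega>)) a" "has_bochner_integral M (\<lambda>\<omega>. g (Y \<omega>)) b"
  shows "has_bochner_integral M (\<lambda>\<omega>. f (X \<omega>) * g (Y \<omega>)) (a * b)"
  using indep_rv_integral_mult[OF assms(1-3)] assms(4,5) by (simp add: has_bochner_integral_iff)

text \<open>Events of \<open>F\<close> have the form that \<open>y\<close> lies in \<open>B\<close>.
  It suffices to integrate \<open>D\<close> over each of them and to find the stated constant times
  the probability of the event.\<close>

lemma cond_exp_improvement:
  fixes \<delta> :: "'a \<Rightarrow> real^'n" and \<eta>S y :: "'a \<Rightarrow> 'n \<Rightarrow> real" and \<eta> D :: "'a \<Rightarrow> real" and w :: "real^'n"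
  assumes Q: "posdef Q" and R: "posdef_on S R" and i: "i \<notin> S" and \<sigma>: "0 < \<sigma>"
    and delta: "gaussian_on M UNIV (\<lambda>\<omega> j. \<delta> \<omega> $ j) (\<lambda>_. 0) (\<lambda>j l. matrix_inv Q $ j $ l)"
    and etaS: "gaussian_on M S \<eta>S (\<lambda>_. 0) R"
    and etaS_indep: "indep_rv M borel \<delta> (PiM S (\<lambda>_. borel)) \<eta>S"
    and eta: "distributed M lborel \<eta> (\<lambda>v. ennreal (normal_density 0 \<sigma> v))"
    and eta_indep: "indep_rv M (borel \<Otimes>\<^sub>M PiM S (\<lambda>_. borel)) (\<lambda>\<omega>. (\<delta> \<omega>, \<eta>S \<omega>)) borel \<eta>"
    and y: "\<And>\<omega>. y \<omega> = observe S (x + \<delta> \<omega>) (\<eta>S \<omega>)"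
    and D: "\<And>\<omega>. D \<omega> =
      weighted_norm_sq (diag_matrix w) (x + \<delta> \<omega> - refined_estimate Q S R x \<rho> (y \<omega>)) -
      weighted_norm_sq (diag_matrix w) (x + \<delta> \<omega> -
        refined_estimate Q (insert i S) (extend_cov S R i (\<sigma>\<^sup>2)) x \<rho>
          (observe (insert i S) (x + \<delta> \<omega>) ((\<eta>S \<omega>)(i := \<eta> \<omega>))))"
    and F: "F = vimage_algebra (space M) y (PiM S (\<lambda>_. borel))"
  shows "integrable M D"
    "AE \<omega> in M. real_cond_exp M F D \<omega> = (2 * \<rho> - \<rho>\<^sup>2) * utility (diag_matrix w) Q S R (\<sigma>\<^sup>2) i"
proof -
  let ?B = "PiM S (\<lambda>_. borel :: real measure)"
  define r where "r \<omega> = \<delta> \<omega> - post_mean Q S R x (y \<omega>)" for \<omega>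
  define k where "k = kalman_gain (post_cov Q S R) (\<sigma>\<^sup>2) i"
  define a where "a = diag_matrix w *v k"
  define e where "e = (axis i 1 :: real^'n)"
  define P where "P = post_cov Q S R"
  define U where "U = utility (diag_matrix w) Q S R (\<sigma>\<^sup>2) i"
  define m where "m = post_mean Q S R x"
  have s: "0 < \<sigma>\<^sup>2" using \<sigma> by simp
  obtain c1 c2 where c: "0 < c1" "0 < c2"
    and dD: "distributed M lborel \<delta> (\<lambda>v. ennreal (c1 * exp (- (v \<bullet> (Q *v v)) / 2)))"
    and dE: "distributed M (PiM S (\<lambda>_. lborel)) \<eta>S
      (\<lambda>e. ennreal (c2 * exp (- (\<Sum>j\<in>S. \<Sum>l\<in>S. e j * inverse_on S R j l * e l) / 2)))"
    using gaussian_on_UNIV_density[OF Q delta] gaussian_on_centered_density[OF etaS] by blast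
  note res = posterior_residual[OF Q R c dD dE etaS_indep y r_def]
  obtain c3 where dr: "distributed M lborel r (\<lambda>v. ennreal (c3 * exp (- (v \<bullet> (post_precision Q S R *v v)) / 2)))"
    using res(2) by blast
  have \<delta>_meas[measurable]: "\<delta> \<in> borel_measurable M" and \<eta>S_meas[measurable]: "\<eta>S \<in> measurable M ?B"
    using etaS_indep by (simp_all add: indep_rv_def)
  have y_meas[measurable]: "y \<in> measurable M ?B"
    using res(1) by (simp add: indep_rv_def)
  have m_meas[measurable]: "m \<in> borel_measurable ?B"
    unfolding m_def by (rule borel_measurable_post_mean)
  have obs_meas[measurable]: "(\<lambda>(d, n). observe S (x + d) n) \<in> measurable (borel \<Otimes>\<^sub>M ?B) ?B"
    unfolding observe_def inner_obs_row by measurable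
  note r_mom = distributed_gaussian_moments[OF dr posdef_post_precision[OF Q R], folded post_cov_def P_def]
  note \<eta>_mom = normal_centered_moments[OF eta \<sigma>]
  \<comment> \<open>The posterior mean is the difference of the prior and posterior residuals, which
    both have integrable components.\<close>
  have int_m: "integrable M (\<lambda>\<omega>. u \<bullet> m (y \<omega>))" for u
  proof -
    have "u \<bullet> m (y \<omega>) = u \<bullet> \<delta> \<omega> - u \<bullet> r \<omega>" for \<omega>
      by (simp add: r_def m_def inner_diff_right)
    then show ?thesis
      using distributed_gaussian_moments(1)[OF dD Q] r_mom(1) by simp
  qed
  have r_m: "r \<omega> = \<delta> \<omega> - m (y \<omega>)" for \<omega>
    unfolding r_def m_def ..
  have D_eq: "D \<omega> = 2 * \<rho> * ((e \<bullet> r \<omega> + \<eta> \<omega>) * (a \<bullet> r \<omega> + (1 - \<rho>) * (a \<bullet> m (y \<omega>))))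
      - \<rho>\<^sup>2 * (a \<bullet> k) * (e \<bullet> r \<omega> + \<eta> \<omega>)\<^sup>2" for \<omega>
    unfolding D a_def e_def m_def
    by (rule refined_estimate_improvement[OF Q R i s transpose_diag_matrix _ _ r_def k_def])
       (use i in \<open>auto simp: y observe_def inner_obs_row\<close>)
  have HB: "has_bochner_integral M (\<lambda>\<omega>. D \<omega> * indicator B (y \<omega>)) ((2 * \<rho> - \<rho>\<^sup>2) * U * prob (y -` B \<inter> space M))"
    if B[measurable]: "B \<in> sets ?B" for B
  proof -
    let ?p = "prob (y -` B \<inter> space M)"
    let ?I = "\<lambda>\<omega>. indicator B (y \<omega>) :: real"
    have I: "has_bochner_integral M ?I ?p"
    proof -
      have "has_bochner_integral M (indicator (y -` B \<inter> space M) :: 'a \<Rightarrow> real) ?p"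
        by (rule has_bochner_integral_real_indicator) (auto simp: emeasure_eq_measure)
      then show ?thesis
        by (rule has_bochner_integral_cong[THEN iffD1, rotated -1]) (auto simp: indicator_def)
    qed
    have rI: "has_bochner_integral M (\<lambda>\<omega>. (u \<bullet> r \<omega>) * ?I \<omega>) 0" for u
      using indep_rv_has_integral_mult[OF res(1), of "\<lambda>v. u \<bullet> v" "indicator B" 0 ?p] r_mom(1,2)[of u] I
      by (simp add: has_bochner_integral_iff)
    have rrI: "has_bochner_integral M (\<lambda>\<omega>. (u \<bullet> r \<omega>) * (v \<bullet> r \<omega>) * ?I \<omega>) (u \<bullet> (P *v v) * ?p)" for u v
      using r_mom(3,4)[of u v] I
      by (intro indep_rv_has_integral_mult[OF res(1), of "\<lambda>x. (u \<bullet> x) * (v \<bullet> x)" "indicator B"])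
         (auto simp: has_bochner_integral_iff)
    have mI: "integrable M (\<lambda>\<omega>. (u \<bullet> m (y \<omega>)) * ?I \<omega>)" for u
      by (rule Bochner_Integration.integrable_bound[OF int_m[of u]]) (auto simp: indicator_def)
    \<comment> \<open>The posterior mean and the indicator are functions of \<open>y\<close>, hence
      independent of the centered \<open>r\<close>.\<close>
    have rmI: "has_bochner_integral M (\<lambda>\<omega>. (u \<bullet> r \<omega>) * ((v \<bullet> m (y \<omega>)) * ?I \<omega>)) 0" for u v
      using indep_rv_has_integral_mult[OF res(1), of "\<lambda>x. u \<bullet> x" "\<lambda>z. (v \<bullet> m z) * indicator B z" 0
          "expectation (\<lambda>\<omega>. (v \<bullet> m (y \<omega>)) * ?I \<omega>)"] r_mom(1,2)[of u] mI[of v]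
      by (simp add: has_bochner_integral_iff)
    \<comment> \<open>Since \<open>y\<close> is a function of \<open>\<delta>\<close> and
      \<open>\<eta>S\<close>, the new noise is independent of every function of
      \<open>\<delta>\<close> and \<open>y\<close>.\<close>
    have eta_mult: "has_bochner_integral M (\<lambda>\<omega>. f (\<delta> \<omega>) (y \<omega>) * g (\<eta> \<omega>)) (expectation (\<lambda>\<omega>. f (\<delta> \<omega>) (y \<omega>)) * b)"
      if f: "(\<lambda>(d, z). f d z) \<in> borel_measurable (borel \<Otimes>\<^sub>M ?B)" and g: "g \<in> borel_measurable borel"
        and int: "integrable M (\<lambda>\<omega>. f (\<delta> \<omega>) (y \<omega>))" "has_bochner_integral M (\<lambda>\<omega>. g (\<eta> \<omega>)) b" for f b and g :: "real \<Rightarrow> real"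
    proof -
      have "(\<lambda>q. f (fst q) (case q of (d, n) \<Rightarrow> observe S (x + d) n)) \<in> borel_measurable (borel \<Otimes>\<^sub>M ?B)"
        using measurable_compose[OF measurable_Pair[OF measurable_fst obs_meas] f] by simp
      from indep_rv_has_integral_mult[OF eta_indep this g, of "expectation (\<lambda>\<omega>. f (\<delta> \<omega>) (y \<omega>))" b] int
      show ?thesis by (simp add: y has_bochner_integral_iff)
    qed
    have \<eta>1: "has_bochner_integral M (\<lambda>\<omega>. \<eta> \<omega>) 0" and \<eta>2: "has_bochner_integral M (\<lambda>\<omega>. (\<eta> \<omega>)\<^sup>2) (\<sigma>\<^sup>2)"
      using \<eta>_mom by (simp_all add: has_bochner_integral_iff)
    have r\<eta>I: "has_bochner_integral M (\<lambda>\<omega>. (u \<bullet> r \<omega>) * ?I \<omega> * \<eta> \<omega>) 0" for u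
    proof -
      have int: "integrable M (\<lambda>\<omega>. (u \<bullet> (\<delta> \<omega> - m (y \<omega>))) * ?I \<omega>)"
        using rI[of u] unfolding has_bochner_integral_iff r_m by blast
      have "(\<lambda>(d, z). (u \<bullet> (d - m z)) * indicator B z :: real) \<in> borel_measurable (borel \<Otimes>\<^sub>M ?B)"
        by measurable
      from eta_mult[OF this measurable_ident_sets[OF refl] int \<eta>1] show ?thesis
        unfolding r_m mult_zero_right .
    qed
    have m\<eta>I: "has_bochner_integral M (\<lambda>\<omega>. (u \<bullet> m (y \<omega>)) * ?I \<omega> * \<eta> \<omega>) 0" for u
    proof -
      have "(\<lambda>(d :: real^'n, z). (u \<bullet> m z) * indicator B z :: real) \<in> borel_measurable (borel \<Otimes>\<^sub>M ?B)"
        by measurable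
      from eta_mult[OF this measurable_ident_sets[OF refl] mI \<eta>1] show ?thesis
        unfolding mult_zero_right .
    qed
    have \<eta>\<eta>I: "has_bochner_integral M (\<lambda>\<omega>. ?I \<omega> * (\<eta> \<omega>)\<^sup>2) (?p * \<sigma>\<^sup>2)"
    proof -
      have f: "(\<lambda>(d :: real^'n, z). indicator B z :: real) \<in> borel_measurable (borel \<Otimes>\<^sub>M ?B)"
        by measurable
      have g: "(\<lambda>t :: real. t\<^sup>2) \<in> borel_measurable borel" by measurable
      have int: "integrable M ?I" and "expectation ?I = ?p"
        using I by (simp_all only: has_bochner_integral_iff)
      with eta_mult[OF f g int \<eta>2] show ?thesis by (simp only:)
    qed
    \<comment> \<open>The improvement times the indicator, expanded into products whose integrals
      were found above. Only the products quadratic in \<open>r\<close> or in \<open>\<eta>\<close>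
      have a nonzero contribution.\<close>
    let ?S = "\<lambda>\<omega>. 2 * \<rho> * ((e \<bullet> r \<omega>) * (a \<bullet> r \<omega>) * ?I \<omega> + (1 - \<rho>) * ((e \<bullet> r \<omega>) * ((a \<bullet> m (y \<omega>)) * ?I \<omega>))
        + (a \<bullet> r \<omega>) * ?I \<omega> * \<eta> \<omega> + (1 - \<rho>) * ((a \<bullet> m (y \<omega>)) * ?I \<omega> * \<eta> \<omega>))
        - \<rho>\<^sup>2 * (a \<bullet> k) * ((e \<bullet> r \<omega>) * (e \<bullet> r \<omega>) * ?I \<omega> + 2 * ((e \<bullet> r \<omega>) * ?I \<omega> * \<eta> \<omega>) + ?I \<omega> * (\<eta> \<omega>)\<^sup>2)"
    have "has_bochner_integral M ?S
      (2 * \<rho> * (e \<bullet> (P *v a) * ?p + (1 - \<rho>) * 0 + 0 + (1 - \<rho>) * 0)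
        - \<rho>\<^sup>2 * (a \<bullet> k) * (e \<bullet> (P *v e) * ?p + 2 * 0 + ?p * \<sigma>\<^sup>2))"
      by (intro has_bochner_integral_diff has_bochner_integral_add has_bochner_integral_mult_right
          rrI rmI r\<eta>I m\<eta>I \<eta>\<eta>I)
    moreover have "?S \<omega> = D \<omega> * ?I \<omega>" for \<omega>
      unfolding D_eq by (simp add: algebra_simps power2_eq_square)
    moreover have "2 * \<rho> * (e \<bullet> (P *v a) * ?p + (1 - \<rho>) * 0 + 0 + (1 - \<rho>) * 0)
        - \<rho>\<^sup>2 * (a \<bullet> k) * (e \<bullet> (P *v e) * ?p + 2 * 0 + ?p * \<sigma>\<^sup>2) = (2 * \<rho> - \<rho>\<^sup>2) * U * ?p"
    proof -
      have 1: "e \<bullet> (P *v a) = U" and 2: "(a \<bullet> k) * (e \<bullet> (P *v e) + \<sigma>\<^sup>2) = U"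
        using utility_eq_gain[OF Q R i s k_def a_def] by (simp_all add: e_def P_def U_def)
      have "\<rho>\<^sup>2 * (a \<bullet> k) * (e \<bullet> (P *v e) * ?p + 2 * 0 + ?p * \<sigma>\<^sup>2)
        = \<rho>\<^sup>2 * ((a \<bullet> k) * (e \<bullet> (P *v e) + \<sigma>\<^sup>2)) * ?p"
        by (simp add: algebra_simps)
      then show ?thesis unfolding 1 2 by (simp add: algebra_simps)
    qed
    ultimately show ?thesis by simp
  qed
  have y_space: "y \<omega> \<in> space ?B" if "\<omega> \<in> space M" for \<omega>
    using y_meas that by (rule measurable_space)
  \<comment> \<open>Taking \<open>B\<close> to be the whole space makes the indicator 1 and gives
    integrability of \<open>D\<close> itself.\<close>
  have "has_bochner_integral M D ((2 * \<rho> - \<rho>\<^sup>2) * U * prob (y -` space ?B \<inter> space M))"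
    by (rule has_bochner_integral_cong[THEN iffD1, OF _ _ _ HB]) (auto simp: y_space)
  then show int: "integrable M D"
    by (simp add: has_bochner_integral_iff)
  have sF: "sets F = {y -` B \<inter> space M | B. B \<in> sets ?B}"
    unfolding F by (rule sets_vimage_algebra_rv[OF y_meas])
  have "space F = space M"
    unfolding F by simp
  then have "subalgebra M F"
    unfolding subalgebra_def sF using y_meas by (auto intro: measurable_sets)
  then interpret finite_measure_subalgebra M F
    by unfold_locales
  show "AE \<omega> in M. real_cond_exp M F D \<omega> = (2 * \<rho> - \<rho>\<^sup>2) * utility (diag_matrix w) Q S R (\<sigma>\<^sup>2) i"
    unfolding U_def[symmetric]
  proof (rule real_cond_exp_charact)
    fix A assume "A \<in> sets F"
    then obtain B where B[measurable]: "B \<in> sets ?B" and A: "A = y -` B \<inter> space M"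
      unfolding sF by blast
    have "(\<integral>\<omega>\<in>A. D \<omega> \<partial>M) = (\<integral>\<omega>. D \<omega> * indicator B (y \<omega>) \<partial>M)"
      unfolding set_lebesgue_integral_def A
      by (intro Bochner_Integration.integral_cong) (auto simp: indicator_def)
    also have "\<dots> = (2 * \<rho> - \<rho>\<^sup>2) * U * prob A"
      using HB[OF B] by (simp add: has_bochner_integral_iff A)
    also have "\<dots> = (\<integral>\<omega>\<in>A. (2 * \<rho> - \<rho>\<^sup>2) * U \<partial>M)"
      unfolding A by (simp add: set_lebesgue_integral_def)
    finally show "(\<integral>\<omega>\<in>A. D \<omega> \<partial>M) = (\<integral>\<omega>\<in>A. (2 * \<rho> - \<rho>\<^sup>2) * U \<partial>M)" .
  qed (use int in auto)
qed

end

text \<open>Among the quantities known at round k only \<open>y\<close> is random here, so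
  conditioning is on the \<sigma>-algebra it generates. Conditional expectations are fixed only up
  to null sets; the quantifiers over candidate sets stand inside the almost-everywhere statement, so
  one null set serves them all.\<close>

theorem corollary1:
  fixes C Q W :: "real^'n^'n" and w :: "real^'n" and xhat :: "real^'n"
    and \<tau> lam \<sigma>\<^sub>y \<rho> :: real
    and S :: "'n set" and R :: "'n \<Rightarrow> 'n \<Rightarrow> real"
    and P F :: "'w measure"
    and \<delta> x\<^sub>0 :: "'w \<Rightarrow> real^'n" and \<eta>S :: "'w \<Rightarrow> 'n \<Rightarrow> real" and \<eta> :: "'n \<Rightarrow> 'w \<Rightarrow> real"
    and y :: "'w \<Rightarrow> 'n \<Rightarrow> real" and y\<^sub>1 :: "'n \<Rightarrow> 'w \<Rightarrow> 'n \<Rightarrow> real"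
    and U :: "'n \<Rightarrow> real" and \<Delta> :: "'n \<Rightarrow> 'w \<Rightarrow> real"
  assumes C_sym: "transpose C = C" and C_nonneg: "\<And>i j. 0 \<le> C $ i $ j"
    and tau: "0 < \<tau>" and lambda: "0 \<le> lam"
    and Q: "Q = prior_precision \<tau> lam C"
    and P: "prob_space P"
    and delta: "gaussian_on P UNIV (\<lambda>\<omega> j. \<delta> \<omega> $ j) (\<lambda>_. 0) (\<lambda>j l. matrix_inv Q $ j $ l)"
    and R: "posdef_on S R"
    and etaS: "gaussian_on P S \<eta>S (\<lambda>_. 0) R"
    and etaS_indep: "indep_rv P borel \<delta> (PiM S (\<lambda>_. borel)) \<eta>S"
    and sigma: "0 < \<sigma>\<^sub>y"
    and eta: "\<And>i. i \<notin> S \<Longrightarrow> distributed P lborel (\<eta> i) (\<lambda>v. ennreal (normal_density 0 \<sigma>\<^sub>y v))"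
    and eta_indep: "\<And>i. i \<notin> S \<Longrightarrow>
      indep_rv P (borel \<Otimes>\<^sub>M PiM S (\<lambda>_. borel)) (\<lambda>\<omega>. (\<delta> \<omega>, \<eta>S \<omega>)) borel (\<eta> i)"
    and x0: "\<And>\<omega>. x\<^sub>0 \<omega> = xhat + \<delta> \<omega>"
    and y: "\<And>\<omega>. y \<omega> = observe S (x\<^sub>0 \<omega>) (\<eta>S \<omega>)"
    and y1: "\<And>i \<omega>. y\<^sub>1 i \<omega> = observe (insert i S) (x\<^sub>0 \<omega>) ((\<eta>S \<omega>)(i := \<eta> i \<omega>))"
    and F: "F = vimage_algebra (space P) y (PiM S (\<lambda>_. borel))"
    and W: "W = diag_matrix w" and W_psd: "possemidef W"
    and rho: "0 < \<rho>"
    and Delta: "\<And>i \<omega>. \<Delta> i \<omega> =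
      weighted_norm_sq W (x\<^sub>0 \<omega> - refined_estimate Q S R xhat \<rho> (y \<omega>)) -
      weighted_norm_sq W (x\<^sub>0 \<omega> -
        refined_estimate Q (insert i S) (extend_cov S R i (\<sigma>\<^sub>y\<^sup>2)) xhat \<rho> (y\<^sub>1 i \<omega>))"
    and U: "\<And>i. U i = utility W Q S R (\<sigma>\<^sub>y\<^sup>2) i"
  shows "(\<forall>i. i \<notin> S \<longrightarrow>
            integrable P (\<Delta> i) \<and>
            (AE \<omega> in P. real_cond_exp P F (\<Delta> i) \<omega> = (2 * \<rho> - \<rho>\<^sup>2) * U i)) \<and>
         (\<rho> < 2 \<longrightarrow>
            (AE \<omega> in P. \<forall>K. K \<noteq> {} \<and> K \<subseteq> - S \<longrightarrow>
               (\<forall>i. is_arg_max U (\<lambda>j. j \<in> K) i \<longrightarrow>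
                    is_arg_max (\<lambda>j. real_cond_exp P F (\<Delta> j) \<omega>) (\<lambda>j. j \<in> K) i)))"
proof -
  interpret prob_space P by (rule P)
  have Qpos: "posdef Q"
    unfolding Q by (rule posdef_prior_precision[OF C_sym C_nonneg tau lambda])
  have main: "integrable P (\<Delta> i)"
    "AE \<omega> in P. real_cond_exp P F (\<Delta> i) \<omega> = (2 * \<rho> - \<rho>\<^sup>2) * U i" if i: "i \<notin> S" for i
  proof -
    have y': "y \<omega> = observe S (xhat + \<delta> \<omega>) (\<eta>S \<omega>)" for \<omega>
      by (simp add: y x0)
    have D: "\<Delta> i \<omega> =
      weighted_norm_sq (diag_matrix w) (xhat + \<delta> \<omega> - refined_estimate Q S R xhat \<rho> (y \<omega>)) -
      weighted_norm_sq (diag_matrix w) (xhat + \<delta> \<omega> -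
        refined_estimate Q (insert i S) (extend_cov S R i (\<sigma>\<^sub>y\<^sup>2)) xhat \<rho>
          (observe (insert i S) (xhat + \<delta> \<omega>) ((\<eta>S \<omega>)(i := \<eta> i \<omega>))))" for \<omega>
      by (simp only: Delta W x0 y1)
    note ce = cond_exp_improvement[OF Qpos R i sigma delta etaS etaS_indep eta[OF i] eta_indep[OF i] y' D F]
    show "integrable P (\<Delta> i)" by (rule ce)
    show "AE \<omega> in P. real_cond_exp P F (\<Delta> i) \<omega> = (2 * \<rho> - \<rho>\<^sup>2) * U i"
      using ce(2) by (simp only: U W)
  qed
  \<comment> \<open>There are finitely many indices, so the exceptional null sets can be united
    before any candidate set is chosen.\<close>
  have "AE \<omega> in P. \<forall>i\<in>- S. real_cond_exp P F (\<Delta> i) \<omega> = (2 * \<rho> - \<rho>\<^sup>2) * U i"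
    using main(2) by (intro AE_finite_allI) auto
  \<comment> \<open>Outside that null set the conditional expectation is a positive multiple of the
    utility, so maximizers carry over.\<close>
  moreover have "0 < 2 * \<rho> - \<rho>\<^sup>2" if "\<rho> < 2"
  proof -
    have "0 < \<rho> * (2 - \<rho>)" using rho that by simp
    then show ?thesis by (simp add: algebra_simps power2_eq_square)
  qed
  ultimately have "AE \<omega> in P. \<forall>K. K \<noteq> {} \<and> K \<subseteq> - S \<longrightarrow>
      (\<forall>i. is_arg_max U (\<lambda>j. j \<in> K) i \<longrightarrow>
        is_arg_max (\<lambda>j. real_cond_exp P F (\<Delta> j) \<omega>) (\<lambda>j. j \<in> K) i)" if "\<rho> < 2"
    using that by (elim eventually_mono) (auto simp: is_arg_max_def subset_eq)
  with main show ?thesis by blast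
qed

end
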